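(* Let $(X,d)$ be a compact metric space and let $f\colon X\to X$ be a continuous map which is chain recurrent and has the s-limit shadowing property. If $h_{top}(f)>0$ (topological entropy), then there are a non-empty Mycielski subset $S$ of $X$ and numbers $\delta_n>0$, $n\ge2$, such that for every $n\ge2$ the set $S$ is distributionally $n$-$\delta_n$-scrambled.
   Context: Let $(X,d)$ be a compact metric space and $f\colon X\to X$ a continuous map. For $\delta>0$, a finite sequence $(x_i)_{i=0}^k$ in $X$ ($k$ a positive integer) is a $\delta$-chain of $f$ if $d(f(x_i),x_{i+1})\le\delta$ for every $0\le i\le k-1$. A point $x\in X$ is chain recurrent for $f$ if for every $\delta>0$ there is a $\delta$-chain $(x_i)_{i=0}^k$ of $f$ with $x_0=x_k=x$. $f$ is chain recurrent if every $x\in X$ is a chain recurrent point for $f$. s-limit shadowing. For $\delta>0$, a sequence $(x_i)_{i\ge0}$ in $X$ is a $\delta$-limit-pseudo orbit of $f$ if $d(f(x_i),x_{i+1})\le\delta$ for all $i\ge0$ and $\lim_{i\to\infty}d(f(x_i),x_{i+1})=0$. It is $\epsilon$-limit shadowed by $x\in X$ if $d(f^i(x),x_i)\le\epsilon$ for all $i\ge0$ and $\lim_{i\to\infty}d(f^i(x),x_i)=0$. $f$ has the s-limit shadowing property if for every $\epsilon>0$ there is $\delta>0$ such that every $\delta$-limit-pseudo orbit of $f$ is $\epsilon$-limit shadowed by some point of $X$. Distributional scrambling. For $n\ge2$ and $\delta>0$, an $n$-tuple $(x_1,\dots,x_n)\in X^n$ is distributionally $n$-$\delta$-scrambled if $$\limsup_{m\to\infty}\frac1m\left|\{0\le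 k\le m-1\colon \max_{1\le i<j\le n}d(f^k(x_i),f^k(x_j))<\epsilon\}\right|=1\quad\text{for all }\epsilon>0,$$ and $$\limsup_{m\to\infty}\frac1m\left|\{0\le k\le m-1\colon \min_{1\le i<j\le n}d(f^k(x_i),f^k(x_j))>\delta\}\right|=1.$$ A set $S\subset X$ is distributionally $n$-$\delta$-scrambled if $(x_1,\dots,x_n)$ is distributionally $n$-$\delta$-scrambled for any distinct $x_1,\dots,x_n\in S$. A subset $S$ of $X$ is a Mycielski set if it is a union of countably many Cantor sets. *)

theory Defs
  imports "HOL-Analysis.Analysis"
begin

definition delta_chain :: "'a::metric_space set \<Rightarrow> ('a \<Rightarrow> 'a) \<Rightarrow> real \<Rightarrow> nat \<Rightarrow> (nat \<Rightarrow> 'a) \<Rightarrow> bool" where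
  "delta_chain X f \<delta> k x \<longleftrightarrow>
     k > 0 \<and> (\<forall>i\<le>k. x i \<in> X) \<and> (\<forall>i<k. dist (f (x i)) (x (Suc i)) \<le> \<delta>)"

definition chain_recurrent_point :: "'a::metric_space set \<Rightarrow> ('a \<Rightarrow> 'a) \<Rightarrow> 'a \<Rightarrow> bool" where
  "chain_recurrent_point X f p \<longleftrightarrow>
     (\<forall>\<delta>>0. \<exists>k x. delta_chain X f \<delta> k x \<and> x 0 = p \<and> x k = p)"

definition chain_recurrent :: "'a::metric_space set \<Rightarrow> ('a \<Rightarrow> 'a) \<Rightarrow> bool" where
  "chain_recurrent X f \<longleftrightarrow> (\<forall>p\<in>X. chain_recurrent_point X f p)"

definition limit_pseudo_orbit :: "'a::metric_space set \<Rightarrow> ('a \<Rightarrow> 'a) \<Rightarrow> real \<Rightarrow> (nat \<Rightarrow> 'a) \<Rightarrow> bool" where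
  "limit_pseudo_orbit X f \<delta> x \<longleftrightarrow>
     (\<forall>i. x i \<in> X) \<and>
     (\<forall>i. dist (f (x i)) (x (Suc i)) \<le> \<delta>) \<and>
     (\<lambda>i. dist (f (x i)) (x (Suc i))) \<longlonglongrightarrow> 0"

definition limit_shadowed :: "('a::metric_space \<Rightarrow> 'a) \<Rightarrow> real \<Rightarrow> (nat \<Rightarrow> 'a) \<Rightarrow> 'a \<Rightarrow> bool" where
  "limit_shadowed f \<epsilon> x p \<longleftrightarrow>
     (\<forall>i. dist ((f ^^ i) p) (x i) \<le> \<epsilon>) \<and>
     (\<lambda>i. dist ((f ^^ i) p) (x i)) \<longlonglongrightarrow> 0"

definition s_limit_shadowing :: "'a::metric_space set \<Rightarrow> ('a \<Rightarrow> 'a) \<Rightarrow> bool" where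
  "s_limit_shadowing X f \<longleftrightarrow>
     (\<forall>\<epsilon>>0. \<exists>\<delta>>0. \<forall>x. limit_pseudo_orbit X f \<delta> x \<longrightarrow> (\<exists>p\<in>X. limit_shadowed f \<epsilon> x p))"

text \<open>Topological entropy is taken in Bowen's form. The condition on a pair of points below says
  that their distance in the Bowen metric \<open>max {dist (f\<^sup>k x) (f\<^sup>k y) | k < n}\<close> exceeds \<open>\<epsilon>\<close>.\<close>

definition separated :: "('a::metric_space \<Rightarrow> 'a) \<Rightarrow> nat \<Rightarrow> real \<Rightarrow> 'a set \<Rightarrow> bool" where
  "separated f n \<epsilon> E \<longleftrightarrow>
     (\<forall>x\<in>E. \<forall>y\<in>E. x \<noteq> y \<longrightarrow> (\<exists>k<n. dist ((f ^^ k) x) ((f ^^ k) y) > \<epsilon>))"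

text \<open>The logarithm of the maximal cardinality of an \<open>(n, \<epsilon>)\<close>-separated subset of \<open>X\<close>. It is a
  supremum in \<open>ereal\<close> so that no prior proof is needed that the maximum exists. The empty set
  contributes \<open>ln 0 = 0\<close>, which is also the value contributed by singletons.\<close>

definition log_max_separated :: "'a::metric_space set \<Rightarrow> ('a \<Rightarrow> 'a) \<Rightarrow> nat \<Rightarrow> real \<Rightarrow> ereal" where
  "log_max_separated X f n \<epsilon> =
     (SUP E\<in>{E. E \<subseteq> X \<and> finite E \<and> separated f n \<epsilon> E}. ereal (ln (real (card E))))"

text \<open>The inner \<open>limsup\<close> increases as \<open>\<epsilon>\<close> decreases, so its limit for \<open>\<epsilon> \<rightarrow> 0\<close> is the supremum
  over \<open>\<epsilon> > 0\<close>. The term at \<open>n = 0\<close> does not affect the \<open>limsup\<close>.\<close>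

definition h_top :: "'a::metric_space set \<Rightarrow> ('a \<Rightarrow> 'a) \<Rightarrow> ereal" where
  "h_top X f = (SUP \<epsilon>\<in>{0<..}. limsup (\<lambda>n. log_max_separated X f n \<epsilon> / ereal (real n)))"

text \<open>Tuples \<open>(x\<^sub>1, \<dots>, x\<^sub>n)\<close> are functions on \<open>nat\<close> of which only the values on \<open>{1..n}\<close> matter.
  For \<open>n \<ge> 2\<close> the set of pairwise distances is finite and nonempty, so that \<open>Max\<close> and \<open>Min\<close>
  are meaningful.\<close>

definition pair_dists :: "nat \<Rightarrow> (nat \<Rightarrow> 'a::metric_space) \<Rightarrow> real set" where
  "pair_dists n y = {dist (y i) (y j) | i j. 1 \<le> i \<and> i < j \<and> j \<le> n}"

definition dist_scrambled_tuple :: "('a::metric_space \<Rightarrow> 'a) \<Rightarrow> nat \<Rightarrow> real \<Rightarrow> (nat \<Rightarrow> 'a) \<Rightarrow> bool" where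
  "dist_scrambled_tuple f n \<delta> x \<longleftrightarrow>
     (\<forall>\<epsilon>>0. limsup (\<lambda>m. ereal (real (card {k. k < m \<and>
          Max (pair_dists n (\<lambda>i. (f ^^ k) (x i))) < \<epsilon>}) / real m)) = 1) \<and>
     limsup (\<lambda>m. ereal (real (card {k. k < m \<and>
          Min (pair_dists n (\<lambda>i. (f ^^ k) (x i))) > \<delta>}) / real m)) = 1"

definition dist_scrambled_set :: "('a::metric_space \<Rightarrow> 'a) \<Rightarrow> nat \<Rightarrow> real \<Rightarrow> 'a set \<Rightarrow> bool" where
  "dist_scrambled_set f n \<delta> S \<longleftrightarrow>
     (\<forall>x. x ` {1..n} \<subseteq> S \<and> inj_on x {1..n} \<longrightarrow> dist_scrambled_tuple f n \<delta> x)"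

text \<open>The model is \<open>{0,1}\<^sup>\<nat>\<close> with the product of the discrete topologies.\<close>

definition cantor_set :: "'a::topological_space set \<Rightarrow> bool" where
  "cantor_set C \<longleftrightarrow> C homeomorphic (UNIV :: (nat \<Rightarrow> bool) set)"

definition mycielski_set :: "'a::topological_space set \<Rightarrow> bool" where
  "mycielski_set S \<longleftrightarrow> (\<exists>\<C>. countable \<C> \<and> (\<forall>C\<in>\<C>. cantor_set C) \<and> S = \<Union>\<C>)"

end

theory Submission
  imports Defs
begin

text \<open>
  The set \<open>S\<close> is a single Cantor set, the image of a continuous injection \<open>\<Phi>\<close> of the space of binary
  sequences.

  If the entropy is positive, then some point \<open>p\<close> splits: there are \<open>a \<noteq> b\<close> such that for every \<open>\<delta> > 0\<close> there
  are \<open>\<delta>\<close>-chains of equal length from \<open>p\<close> to \<open>a\<close> and from \<open>p\<close> to \<open>b\<close>. Without a splitting point the system would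
  be equicontinuous and have entropy \<open>0\<close> (\<open>splitting_point\<close>). Chain recurrence passes to finite products, where it makes
  the chain relation symmetric (\<open>linked_sym\<close>); so there are also chains of equal length from \<open>a\<close> and \<open>b\<close> back
  to \<open>p\<close>. The two resulting loops are a horseshoe made of pseudo-orbits. Shadowing periodic words in the two loops
  gives, for every \<open>n\<close>, points \<open>z 0, \<dots>, z n\<close> that stay \<open>\<eta> n\<close>-apart at all times and can still be reached
  from \<open>p\<close> simultaneously by chains of arbitrary accuracy (\<open>separated_tuple\<close>). The point of
  s-limit shadowing is that a shadowing point of a chain ending at \<open>p\<close> can be chosen asymptotic to the
  orbit of \<open>p\<close>, and hence remains chain related to \<open>p\<close> at every accuracy (\<open>finite_chain_shadowing\<close>).

  The map \<open>\<Phi>\<close> is built in stages (\<open>tracking_map\<close>). Every stage leads all points back to \<open>p\<close>, then lets the point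
  of \<open>\<alpha>\<close> follow one of the orbits of \<open>z 0, \<dots>, z n\<close>, selected by a finite prefix of \<open>\<alpha>\<close>, during a window much
  longer than all the time before it, and returns to \<open>p\<close>. All finite prefix codes are used infinitely often.
  When the code is trivial, all points follow the same orbit, and this gives the proximal half of
  distributional scrambling. For distinct \<open>\<alpha> 1, \<dots>, \<alpha> n\<close> some code gives them different labels,
  and the windows of this code give the separation by \<open>\<eta> n / 2\<close>, a bound that depends on \<open>n\<close> only.
\<close>

section \<open>Chains\<close>

text \<open>A \<open>\<delta>\<close>-chain of length \<open>m\<close> from \<open>x\<close> to \<open>y\<close> is treated as membership of \<open>(x, y)\<close> in the \<open>m\<close>-th power of the
one-step relation, so that concatenation of chains is composition of relation powers.\<close>

definition step_rel :: "'a::metric_space set \<Rightarrow> ('a \<Rightarrow> 'a) \<Rightarrow> real \<Rightarrow> ('a \<times> 'a) set" where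
  "step_rel X f \<delta> = {(x, y). x \<in> X \<and> y \<in> X \<and> dist (f x) y \<le> \<delta>}"

text \<open>The length \<open>m\<close> is the same for all \<open>i \<in> I\<close>: this is the chain relation of the product system on
\<open>X\<^sup>I\<close>. Synchronous chains are what allows several pseudo-orbits to separate and to meet again at a
common time.\<close>

definition linked :: "'a::metric_space set \<Rightarrow> ('a \<Rightarrow> 'a) \<Rightarrow> 'i set \<Rightarrow> ('i \<Rightarrow> 'a) \<Rightarrow> ('i \<Rightarrow> 'a) \<Rightarrow> bool"
  where "linked X f I x y \<longleftrightarrow> (\<forall>\<delta>>0. \<exists>m. \<forall>i\<in>I. (x i, y i) \<in> step_rel X f \<delta> ^^ m)"

lemma chain_mono:
  "\<delta> \<le> \<delta>' \<Longrightarrow> (x, y) \<in> step_rel X f \<delta> ^^ m \<Longrightarrow> (x, y) \<in> step_rel X f \<delta>' ^^ m"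
  unfolding relpow_fun_conv by (fastforce simp: step_rel_def)

lemma loop_power: "(u, u) \<in> R ^^ l \<Longrightarrow> (u, u) \<in> R ^^ (l * k)"
proof (induction k)
  case (Suc k)
  then show ?case using relpow_trans[of u u l R u "l * k"] by simp
qed simp

text \<open>Only the first step sees the initial point, and only through its image under \<open>f\<close>; only the last step
sees the final point. Hence either end of a nonempty chain can be moved at the cost of the
displacement.\<close>

lemma perturb_chain_ends:
  assumes chain: "(x, y) \<in> step_rel X f \<delta> ^^ m" and "0 < m" and "x' \<in> X" "y' \<in> X"
    and x': "dist (f x) (f x') \<le> a" and y': "dist y y' \<le> b"
  shows "(x', y') \<in> step_rel X f (\<delta> + a + b) ^^ m"
proof -
  obtain c where c: "c 0 = x" "c m = y" "\<forall>i<m. (c i, c (Suc i)) \<in> step_rel X f \<delta>"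
    using chain by (auto simp: relpow_fun_conv)
  have a: "0 \<le> a" and b: "0 \<le> b"
    using x' y' zero_le_dist order_trans by blast+
  define c' where "c' = c(0 := x', m := y')"
  have "(c' i, c' (Suc i)) \<in> step_rel X f (\<delta> + a + b)" if "i < m" for i
  proof -
    have step: "c i \<in> X" "c (Suc i) \<in> X" "dist (f (c i)) (c (Suc i)) \<le> \<delta>"
      using c(3) that by (auto simp: step_rel_def)
    have in_X: "c' i \<in> X" "c' (Suc i) \<in> X"
      using step assms(3,4) by (auto simp: c'_def)
    have "dist (f (c' i)) (f (c i)) \<le> a"
      using x' c(1) that a by (auto simp: c'_def dist_commute)
    moreover have "dist (c (Suc i)) (c' (Suc i)) \<le> b"
      using y' c(2) b by (auto simp: c'_def)
    ultimately have "dist (f (c' i)) (c' (Suc i)) \<le> \<delta> + a + b"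
      using step(3) dist_triangle[of "f (c' i)" "c' (Suc i)" "f (c i)"]
        dist_triangle[of "f (c i)" "c' (Suc i)" "c (Suc i)"] by linarith
    with in_X show ?thesis by (simp add: step_rel_def)
  qed
  moreover have "c' 0 = x'" "c' m = y'" using \<open>0 < m\<close> by (auto simp: c'_def)
  ultimately show ?thesis unfolding relpow_fun_conv by blast
qed

lemma linked_trans:
  assumes "linked X f I x y" "linked X f I y z"
  shows "linked X f I x z"
  unfolding linked_def
proof (intro allI impI)
  fix \<delta> :: real assume "\<delta> > 0"
  then obtain m n where "\<forall>i\<in>I. (x i, y i) \<in> step_rel X f \<delta> ^^ m"
      "\<forall>i\<in>I. (y i, z i) \<in> step_rel X f \<delta> ^^ n"
    using assms unfolding linked_def by meson
  then show "\<exists>m. \<forall>i\<in>I. (x i, z i) \<in> step_rel X f \<delta> ^^ m"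
    by (intro exI[of _ "m + n"]) (blast intro: relpow_trans)
qed

section \<open>Dynamics on a compact space\<close>

locale compact_system =
  fixes X :: "'a::metric_space set" and f :: "'a \<Rightarrow> 'a"
  assumes compact: "compact X" and continuous: "continuous_on X f" and maps_into: "f ` X \<subseteq> X"
begin

abbreviation step :: "real \<Rightarrow> ('a \<times> 'a) set" where "step \<equiv> step_rel X f"

lemma iterate_in: "x \<in> X \<Longrightarrow> (f ^^ k) x \<in> X"
  using maps_into by (induction k) auto

lemma iterate_continuous: "continuous_on X (f ^^ k)"
proof (induction k)
  case (Suc k)
  have "continuous_on X (f \<circ> (f ^^ k))"
    using Suc continuous continuous_on_compose continuous_on_subset iterate_in image_subsetI by metis
  then show ?case by simp
qed (simp add: id_def)

lemma orbit_chain: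
  assumes "x \<in> X" "0 \<le> \<delta>" shows "(x, (f ^^ k) x) \<in> step \<delta> ^^ k"
proof -
  have "((f ^^ i) x, (f ^^ Suc i) x) \<in> step \<delta>" for i
    using assms iterate_in[of x i] iterate_in[of x "Suc i"] by (simp add: step_rel_def)
  then show ?thesis unfolding relpow_fun_conv by (intro exI[of _ "\<lambda>i. (f ^^ i) x"]) auto
qed

lemma modulus:
  assumes "0 < \<epsilon>"
  obtains \<eta> where "\<eta> > 0" "\<And>u v k. \<lbrakk>u \<in> X; v \<in> X; dist u v < \<eta>; k \<le> N\<rbrakk> \<Longrightarrow> dist ((f ^^ k) u) ((f ^^ k) v) < \<epsilon>"
proof -
  have "\<exists>\<eta>>0. \<forall>u\<in>X. \<forall>v\<in>X. dist u v < \<eta> \<longrightarrow> dist ((f ^^ k) u) ((f ^^ k) v) < \<epsilon>" for k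
    using compact_uniformly_continuous[OF iterate_continuous compact, of k] assms
    unfolding uniformly_continuous_on_def by (metis dist_commute)
  then obtain \<eta> where \<eta>: "\<And>k. \<eta> k > 0"
      "\<And>k u v. \<lbrakk>u \<in> X; v \<in> X; dist u v < \<eta> k\<rbrakk> \<Longrightarrow> dist ((f ^^ k) u) ((f ^^ k) v) < \<epsilon>"
    by metis
  show thesis
  proof (rule that[of "Min (\<eta> ` {..N})"])
    show "0 < Min (\<eta> ` {..N})" using \<eta>(1) by (subst Min_gr_iff) auto
  next
    fix u v k assume "u \<in> X" "v \<in> X" "dist u v < Min (\<eta> ` {..N})" "k \<le> N"
    then show "dist ((f ^^ k) u) ((f ^^ k) v) < \<epsilon>" by (intro \<eta>(2)) (auto simp: Min_gr_iff)
  qed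
qed

lemma orbit_linked:
  assumes "\<And>i. i \<in> I \<Longrightarrow> x i \<in> X"
  shows "linked X f I x (\<lambda>i. (f ^^ k) (x i))"
  using assms orbit_chain unfolding linked_def by (meson less_imp_le)

section \<open>Positive entropy and splitting of chains\<close>

text \<open>If no point splits, then chains of sufficient accuracy that start at one point and have the same
length end close to each other. Otherwise there would be such pairs of chains with distant ends for
accuracies tending to \<open>0\<close>, and a limit of their initial and final points would be a splitting point.\<close>

lemma splitting_or_equicontinuous:
  assumes "0 < \<epsilon>"
    and no_split: "\<And>p a b. \<lbrakk>p \<in> X; a \<in> X; b \<in> X; \<forall>\<delta>>0. \<exists>m. (p, a) \<in> step \<delta> ^^ m \<and> (p, b) \<in> step \<delta> ^^ m\<rbrakk>
      \<Longrightarrow> a = b"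
  shows "\<exists>\<delta>>0. \<forall>m x y z. (x, y) \<in> step \<delta> ^^ m \<and> (x, z) \<in> step \<delta> ^^ m \<longrightarrow> dist y z \<le> \<epsilon>"
proof (rule ccontr)
  assume neg: "\<not> ?thesis"
  then have "\<exists>m x y z. (x, y) \<in> step (1 / real (Suc j)) ^^ m \<and> (x, z) \<in> step (1 / real (Suc j)) ^^ m \<and> \<epsilon> < dist y z"
    for j
  proof -
    have "0 < 1 / real (Suc j)" by simp
    with neg show ?thesis by (meson not_le)
  qed
  then obtain m x y z where
    chains: "\<And>j. (x j, y j) \<in> step (1 / real (Suc j)) ^^ m j" "\<And>j. (x j, z j) \<in> step (1 / real (Suc j)) ^^ m j"
    and far: "\<And>j. \<epsilon> < dist (y j) (z j)" by metis
  have m_pos: "0 < m j" for j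
    using chains[of j] far[of j] \<open>0 < \<epsilon>\<close> by (cases "m j") auto
  have in_X: "x j \<in> X" "y j \<in> X" "z j \<in> X" for j
  proof -
    obtain k where "m j = Suc k" using m_pos[of j] gr0_conv_Suc by auto
    then show "x j \<in> X" "y j \<in> X" "z j \<in> X"
      using chains[of j] relpow_Suc_D2[of "x j" "y j" k]  by (auto simp: step_rel_def)
  qed
  have "compact (X \<times> X \<times> X)" using compact by (intro compact_Times)
  moreover have "\<forall>j. (x j, y j, z j) \<in> X \<times> X \<times> X" using in_X by auto
  ultimately obtain l and r :: "nat \<Rightarrow> nat" where l: "l \<in> X \<times> X \<times> X" and r: "strict_mono r"
      and lim: "((\<lambda>j. (x j, y j, z j)) \<circ> r) \<longlonglongrightarrow> l"
    unfolding compact_def by (elim allE[of _ "\<lambda>j. (x j, y j, z j)"] impE) (assumption, elim bexE exE conjE, rule that)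
  obtain p a b where pab: "l = (p, a, b)" by (cases l) auto
  have in_X': "p \<in> X" "a \<in> X" "b \<in> X" using l pab by auto
  have lims: "(\<lambda>j. x (r j)) \<longlonglongrightarrow> p" "(\<lambda>j. y (r j)) \<longlonglongrightarrow> a" "(\<lambda>j. z (r j)) \<longlonglongrightarrow> b"
    using tendsto_fst[OF lim] tendsto_fst[OF tendsto_snd[OF lim]] tendsto_snd[OF tendsto_snd[OF lim]]
    by (auto simp: pab comp_def)
  have f_lim: "(\<lambda>j. f (x (r j))) \<longlonglongrightarrow> f p"
    using continuous_on_tendsto_compose[OF continuous lims(1)] in_X in_X' by auto
  have "\<exists>m. (p, a) \<in> step \<delta> ^^ m \<and> (p, b) \<in> step \<delta> ^^ m" if "0 < \<delta>" for \<delta>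
  proof -
    have d3: "0 < \<delta> / 3" using that by simp
    have "(\<lambda>j. 1 / real (Suc (r j))) \<longlonglongrightarrow> 0"
      using LIMSEQ_subseq_LIMSEQ[OF LIMSEQ_inverse_real_of_nat r] by (simp add: comp_def inverse_eq_divide)
    then have "\<forall>\<^sub>F j in sequentially. 1 / real (Suc (r j)) < \<delta> / 3"
      by (rule order_tendstoD) (rule d3)
    then have "\<forall>\<^sub>F j in sequentially. 1 / real (Suc (r j)) < \<delta> / 3 \<and> dist (f (x (r j))) (f p) < \<delta> / 3
        \<and> dist (y (r j)) a < \<delta> / 3 \<and> dist (z (r j)) b < \<delta> / 3"
      using tendstoD[OF f_lim d3] tendstoD[OF lims(2) d3] tendstoD[OF lims(3) d3]
      by (intro eventually_conj)
    then obtain j where j: "1 / real (Suc (r j)) < \<delta> / 3" "dist (f (x (r j))) (f p) < \<delta> / 3"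
        "dist (y (r j)) a < \<delta> / 3" "dist (z (r j)) b < \<delta> / 3"
      by (auto simp: eventually_sequentially)
    have "(p, c) \<in> step \<delta> ^^ m (r j)"
      if "(x (r j), v) \<in> step (1 / real (Suc (r j))) ^^ m (r j)" "c \<in> X" "dist v c < \<delta> / 3" for v c
      using perturb_chain_ends[OF chain_mono[OF less_imp_le[OF j(1)] that(1)] m_pos in_X'(1) that(2)
          less_imp_le[OF j(2)] less_imp_le[OF that(3)]] by simp
    then show ?thesis using chains j in_X' by blast
  qed
  then have "a = b" using no_split in_X' by blast
  moreover have "\<epsilon> \<le> dist a b"
    using tendsto_dist[OF lims(2,3)] far by (intro LIMSEQ_le_const) (auto intro: less_imp_le)
  ultimately show False using \<open>0 < \<epsilon>\<close> by simp
qed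

text \<open>Suppose that there is no splitting point. An orbit is a chain, also after its initial point is moved to
a nearby centre; so by the previous lemma two orbits that start near the same centre stay
\<open>\<epsilon>\<close>-close forever. An \<open>(n, \<epsilon>)\<close>-separated set then contains at most one point per centre, which bounds
its cardinality independently of \<open>n\<close> and gives entropy \<open>0\<close>.\<close>

lemma splitting_point:
  assumes "0 < h_top X f"
  obtains p a b where "p \<in> X" "a \<in> X" "b \<in> X" "a \<noteq> b"
    "\<forall>\<delta>>0. \<exists>m. (p, a) \<in> step \<delta> ^^ m \<and> (p, b) \<in> step \<delta> ^^ m"
proof (rule ccontr)
  assume "\<not> thesis"
  then have no_split: "\<And>p a b. \<lbrakk>p \<in> X; a \<in> X; b \<in> X; \<forall>\<delta>>0. \<exists>m. (p, a) \<in> step \<delta> ^^ m \<and> (p, b) \<in> step \<delta> ^^ m\<rbrakk>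
      \<Longrightarrow> a = b" using that by blast
  have "limsup (\<lambda>n. log_max_separated X f n \<epsilon> / ereal (real n)) \<le> 0" if \<epsilon>: "0 < \<epsilon>" for \<epsilon>
  proof -
    have "\<exists>\<delta>>0. \<forall>m x y z. (x, y) \<in> step \<delta> ^^ m \<and> (x, z) \<in> step \<delta> ^^ m \<longrightarrow> dist y z \<le> \<epsilon>"
      by (rule splitting_or_equicontinuous[OF \<epsilon>]) (rule no_split)
    then obtain \<delta> where "0 < \<delta>"
      and \<delta>: "\<And>m x y z. (x, y) \<in> step \<delta> ^^ m \<Longrightarrow> (x, z) \<in> step \<delta> ^^ m \<Longrightarrow> dist y z \<le> \<epsilon>"
      by blast
    obtain \<eta> where "0 < \<eta>"
      and \<eta>: "\<And>u v k. \<lbrakk>u \<in> X; v \<in> X; dist u v < \<eta>; k \<le> 1\<rbrakk> \<Longrightarrow> dist ((f ^^ k) u) ((f ^^ k) v) < \<delta>"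
      using modulus[OF \<open>0 < \<delta>\<close>] by blast
    define r where "r = min \<eta> (\<epsilon> / 2)"
    have "0 < r" using \<open>0 < \<eta>\<close> \<epsilon> by (simp add: r_def)
    then obtain K where K: "finite K" "K \<subseteq> X" "X \<subseteq> (\<Union>x\<in>K. ball x r)"
      using seq_compact_imp_totally_bounded[OF compact_imp_seq_compact[OF compact]] by meson
    have "\<forall>z\<in>X. \<exists>c. c \<in> K \<and> dist c z < r"
      using K(3) by (auto simp: subset_eq Bex_def)
    from bchoice[OF this] obtain centre where centre: "\<And>z. z \<in> X \<Longrightarrow> centre z \<in> K \<and> dist (centre z) z < r"
      by blast
    \<comment> \<open>Distinct points of a separated set have distinct centres.\<close>
    have card_le: "card E \<le> card K" if E: "E \<subseteq> X" "separated f n \<epsilon> E" for E n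
    proof (rule card_inj_on_le[OF _ _ K(1)])
      show "centre ` E \<subseteq> K" using centre E by blast
      show "inj_on centre E"
      proof (rule inj_onI, rule ccontr)
        fix z z' assume z: "z \<in> E" "z' \<in> E" "centre z = centre z'" "z \<noteq> z'"
        then obtain k where k: "\<epsilon> < dist ((f ^^ k) z) ((f ^^ k) z')"
          using E(2) by (auto simp: separated_def)
        have "k \<noteq> 0"
        proof
          assume "k = 0"
          moreover have "z \<in> X" "z' \<in> X" using z E by auto
          then have "dist z z' < \<epsilon>"
            using centre[of z] centre[of z'] z dist_triangle3[of z z' "centre z"]
            by (auto simp: r_def)
          ultimately show False using k by simp
        qed
        have "(centre z, (f ^^ k) w) \<in> step \<delta> ^^ k" if w: "w \<in> X" "centre w = centre z" for w
        proof -
          have "dist (f w) (f (centre z)) \<le> \<delta>"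
            using \<eta>[of w "centre z" 1] centre[of w] w K(2) by (auto simp: r_def dist_commute less_imp_le)
          then show ?thesis
            using perturb_chain_ends[OF orbit_chain[of w 0 k], of "centre z" "(f ^^ k) w" \<delta> 0]
              \<open>k \<noteq> 0\<close> w centre[of w] K(2) iterate_in by auto
        qed
        then have "dist ((f ^^ k) z) ((f ^^ k) z') \<le> \<epsilon>" using \<delta> z E by (metis subsetD)
        then show False using k by simp
      qed
    qed
    define C where "C = ln (real (Suc (card K)))"
    have bound: "log_max_separated X f n \<epsilon> \<le> ereal C" for n
      unfolding log_max_separated_def
    proof (rule SUP_least, clarify)
      fix E assume E: "E \<subseteq> X" "finite E" "separated f n \<epsilon> E"
      show "ereal (ln (real (card E))) \<le> ereal C"
        using card_le[OF E(1,3)] by (cases "card E = 0") (auto simp: C_def)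
    qed
    have "limsup (\<lambda>n. log_max_separated X f n \<epsilon> / ereal (real n)) \<le> limsup (\<lambda>n. ereal (C / real n))"
    proof (rule Limsup_mono)
      show "\<forall>\<^sub>F n in sequentially. log_max_separated X f n \<epsilon> / ereal (real n) \<le> ereal (C / real n)"
        using eventually_gt_at_top[of 0]
      proof eventually_elim
        case (elim n)
        then show ?case using ereal_divide_right_mono[OF bound[of n], of "ereal (real n)"] by simp
      qed
    qed
    also have "\<dots> = 0"
    proof (rule lim_imp_Limsup)
      show "(\<lambda>n. ereal (C / real n)) \<longlonglongrightarrow> 0"
        using tendsto_ereal[OF lim_const_over_n[of C]] by (simp add: zero_ereal_def)
    qed simp
    finally show ?thesis .
  qed
  then have "h_top X f \<le> 0" unfolding h_top_def by (intro SUP_least) auto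
  with assms show False by simp
qed

end

section \<open>Symmetry of the chain relation under chain recurrence\<close>

locale chain_recurrent_system = compact_system +
  assumes chain_recurrent: "chain_recurrent X f"
begin

lemma loop:
  assumes "u \<in> X" "0 < \<delta>" shows "\<exists>l>0. (u, u) \<in> step \<delta> ^^ l"
proof -
  obtain k c where c: "delta_chain X f \<delta> k c" "c 0 = u" "c k = u"
    using assms chain_recurrent unfolding chain_recurrent_def chain_recurrent_point_def by blast
  then have "(u, u) \<in> step \<delta> ^^ k"
    unfolding relpow_fun_conv delta_chain_def step_rel_def by (intro exI[of _ c]) auto
  then show ?thesis using c(1) by (auto simp: delta_chain_def)
qed

text \<open>A multiple of a loop length is a loop length, so finitely many points have a common one. The bound
\<open>2 \<le> l\<close> keeps the loop nonempty after its first step is removed.\<close>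

lemma common_loop_length:
  assumes "finite F" "F \<subseteq> X" "0 < \<delta>"
  shows "\<exists>l\<ge>2. \<forall>u\<in>F. (u, u) \<in> step \<delta> ^^ l"
  using assms(1,2)
proof (induction F)
  case (insert v F)
  then obtain l where l: "l \<ge> 2" "\<forall>u\<in>F. (u, u) \<in> step \<delta> ^^ l" by auto
  obtain k where k: "k > 0" "(v, v) \<in> step \<delta> ^^ k" using loop[of v \<delta>] insert.prems assms(3) by auto
  have "\<forall>u\<in>insert v F. (u, u) \<in> step \<delta> ^^ (l * k)"
    using l(2) loop_power[of _ l "step \<delta>" k] loop_power[OF k(2), of l] by (auto simp: mult.commute)
  moreover have "l * k \<ge> 2" using l(1) k(1) mult_le_mono[of 2 l 1 k] by auto
  ultimately show ?case by blast
qed auto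

text \<open>A single step \<open>u \<rightarrow> v\<close> is reversed by a loop \<open>u \<rightarrow> w \<rightarrow> \<dots> \<rightarrow> u\<close>: both \<open>v\<close> and \<open>w\<close> are close to \<open>f u\<close>, so
\<open>v\<close> may replace \<open>w\<close> at the beginning of the rest of the loop. Giving all loops in question the same
length \<open>l\<close>, every step becomes a reversed chain of length \<open>l - 1\<close>, and the reversed chains of all
coordinates have the same total length.\<close>

lemma linked_sym:
  assumes "finite I" and "linked X f I x y"
  shows "linked X f I y x"
  unfolding linked_def
proof (intro allI impI)
  fix \<delta> :: real assume "0 < \<delta>"
  obtain \<eta> where "0 < \<eta>"
    and \<eta>: "\<And>u v k. \<lbrakk>u \<in> X; v \<in> X; dist u v < \<eta>; k \<le> 1\<rbrakk> \<Longrightarrow> dist ((f ^^ k) u) ((f ^^ k) v) < \<delta> / 2"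
    using modulus[of "\<delta> / 2"] \<open>0 < \<delta>\<close> by auto
  define \<delta>' where "\<delta>' = min (\<delta> / 2) (\<eta> / 3)"
  have "0 < \<delta>'" using \<open>0 < \<delta>\<close> \<open>0 < \<eta>\<close> by (simp add: \<delta>'_def)
  obtain m where "\<forall>i\<in>I. (x i, y i) \<in> step \<delta>' ^^ m"
    using assms(2) \<open>0 < \<delta>'\<close> unfolding linked_def by blast
  then obtain c where c: "\<And>i. i \<in> I \<Longrightarrow> c i 0 = x i" "\<And>i. i \<in> I \<Longrightarrow> c i m = y i"
      "\<And>i k. i \<in> I \<Longrightarrow> k < m \<Longrightarrow> (c i k, c i (Suc k)) \<in> step \<delta>'"
    unfolding relpow_fun_conv by metis
  define F where "F = (\<lambda>(i, k). c i k) ` (I \<times> {..<m})"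
  have "finite F" "F \<subseteq> X" using assms(1) c(3) by (auto simp: F_def step_rel_def)
  then obtain l where l: "l \<ge> 2" "\<forall>u\<in>F. (u, u) \<in> step \<delta>' ^^ l"
    using common_loop_length \<open>0 < \<delta>'\<close> by meson
  obtain l' where l': "l = Suc l'" "0 < l'" using l(1) by (cases l) auto
  have backward: "(v, u) \<in> step \<delta> ^^ l'" if u: "u \<in> F" and uv: "(u, v) \<in> step \<delta>'" for u v
  proof -
    obtain w where w: "(u, w) \<in> step \<delta>'" "(w, u) \<in> step \<delta>' ^^ l'"
      using l(2) u l' relpow_Suc_D2 by metis
    have in_X: "u \<in> X" "v \<in> X" "w \<in> X" using w uv by (auto simp: step_rel_def)
    have "dist w v < \<eta>"
      using w(1) uv dist_triangle3[of w v "f u"] \<open>0 < \<eta>\<close> by (auto simp: step_rel_def \<delta>'_def)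
    then have "dist (f w) (f v) \<le> \<delta> / 2" using \<eta>[of w v 1] in_X by auto
    then have "(v, u) \<in> step (\<delta>' + \<delta> / 2 + 0) ^^ l'"
      using perturb_chain_ends[OF w(2) l'(2) in_X(2,1), of "\<delta> / 2" 0] by auto
    then show ?thesis by (rule chain_mono[rotated]) (simp add: \<delta>'_def)
  qed
  have "(c i k, x i) \<in> step \<delta> ^^ (k * l')" if "i \<in> I" "k \<le> m" for i k
    using that(2)
  proof (induction k)
    case (Suc k)
    have "(c i (Suc k), c i k) \<in> step \<delta> ^^ l'"
      using that(1) Suc.prems c(3) by (intro backward) (auto simp: F_def)
    with Suc show ?case using relpow_trans[of "c i (Suc k)" "c i k" l' "step \<delta>" "x i"] by auto
  qed (simp add: c that)
  then show "\<exists>m. \<forall>i\<in>I. (y i, x i) \<in> step \<delta> ^^ m" using c(2) by (metis order_refl)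
qed

text \<open>The final points are moved within the last step; a loop is appended so that there is a last step.\<close>

lemma linked_closed:
  assumes "finite I" and y: "\<And>i. i \<in> I \<Longrightarrow> y i \<in> X"
    and approx: "\<And>\<eta>. 0 < \<eta> \<Longrightarrow> \<exists>y'. linked X f I x y' \<and> (\<forall>i\<in>I. y' i \<in> X \<and> dist (y' i) (y i) \<le> \<eta>)"
  shows "linked X f I x y"
  unfolding linked_def
proof (intro allI impI)
  fix \<delta> :: real assume "0 < \<delta>"
  then obtain y' where y': "linked X f I x y'" "\<And>i. i \<in> I \<Longrightarrow> y' i \<in> X" "\<And>i. i \<in> I \<Longrightarrow> dist (y' i) (y i) \<le> \<delta> / 2"
    using approx[of "\<delta> / 2"] by auto
  obtain m where m: "\<forall>i\<in>I. (x i, y' i) \<in> step (\<delta> / 2) ^^ m"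
    using y'(1) \<open>0 < \<delta>\<close> unfolding linked_def by (meson half_gt_zero)
  obtain l where l: "l \<ge> 2" "\<forall>u\<in>y' ` I. (u, u) \<in> step (\<delta> / 2) ^^ l"
    using common_loop_length[of "y' ` I" "\<delta> / 2"] assms(1) y'(2) \<open>0 < \<delta>\<close> by auto
  have "(x i, y i) \<in> step \<delta> ^^ (m + l)" if "i \<in> I" for i
  proof -
    have "(y' i, y i) \<in> step (\<delta> / 2 + 0 + \<delta> / 2) ^^ l"
      using l that y' y by (intro perturb_chain_ends[where x = "y' i" and y = "y' i"]) auto
    then have "(y' i, y i) \<in> step \<delta> ^^ l" by simp
    moreover have "(x i, y' i) \<in> step \<delta> ^^ m"
      using m that \<open>0 < \<delta>\<close> chain_mono[of "\<delta> / 2" \<delta> "x i" "y' i" m X f] by auto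
    ultimately show ?thesis using relpow_trans by metis
  qed
  then show "\<exists>m. \<forall>i\<in>I. (x i, y i) \<in> step \<delta> ^^ m" by blast
qed

end

section \<open>Compactness of tuples and concatenation of paths\<close>

lemma convergent_tuple_subsequence:
  fixes u :: "nat \<Rightarrow> 'i::countable \<Rightarrow> 'a::metric_space"
  assumes "compact X" and "\<And>t i. u t i \<in> X"
  obtains z r where "strict_mono r" "\<And>i. z i \<in> X" "\<And>i. (\<lambda>t. u (r t) i) \<longlonglongrightarrow> z i"
proof -
  have "compactin (product_topology (\<lambda>i::'i. euclidean :: 'a topology) UNIV) (PiE UNIV (\<lambda>i. X))"
    using assms(1) by (simp add: compactin_PiE)
  then have "compact (PiE UNIV (\<lambda>i::'i. X))"
    by (simp add: euclidean_product_topology)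
  then have "seq_compact (PiE UNIV (\<lambda>i::'i. X))" by (rule compact_imp_seq_compact)
  moreover have "\<forall>t. u t \<in> PiE UNIV (\<lambda>i::'i. X)" using assms(2) by auto
  ultimately obtain z r where z: "z \<in> PiE UNIV (\<lambda>i::'i. X)" "strict_mono r" "(u \<circ> r) \<longlonglongrightarrow> z"
    by (rule seq_compactE)
  have "(\<lambda>t. u (r t) i) \<longlonglongrightarrow> z i" for i
    using continuous_on_tendsto_compose[OF continuous_on_product_coordinates[of i] z(3)]
    by (simp add: comp_def)
  then show thesis using z(1,2) by (intro that[of r z]) auto
qed

definition splice :: "nat \<Rightarrow> (nat \<Rightarrow> 'a) \<Rightarrow> (nat \<Rightarrow> 'a) \<Rightarrow> nat \<Rightarrow> 'a" where
  "splice K x y k = (if k < K then x k else y (k - K))"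

lemma splice_left: "x K = y 0 \<Longrightarrow> k \<le> K \<Longrightarrow> splice K x y k = x k"
  by (auto simp: splice_def)

lemma splice_right: "splice K x y (K + k) = y k"
  by (auto simp: splice_def)

lemma splice_chain:
  assumes x: "\<And>k. k < K \<Longrightarrow> (x k, x (Suc k)) \<in> R" and y: "\<And>k. k < n \<Longrightarrow> (y k, y (Suc k)) \<in> R"
    and "x K = y 0" "k < K + n"
  shows "(splice K x y k, splice K x y (Suc k)) \<in> R"
proof (cases "k < K")
  case True
  then show ?thesis using x[of k] assms(3) splice_left[of x K y] by auto
next
  case False
  then show ?thesis using y[of "k - K"] assms(4) by (auto simp: splice_def Suc_diff_le)
qed

section \<open>Shadowing of chains that end at a base point\<close>

text \<open>The remaining constructions describe a pseudo-orbit on a finite time interval and let it end at a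
base point \<open>p\<close>; shadowing then yields genuine orbits.\<close>

locale limit_shadowing_system = chain_recurrent_system +
  assumes limit_shadowing: "s_limit_shadowing X f"
begin

text \<open>The delay \<open>M\<close> is recorded because points of equal delay can be led to \<open>p\<close> in the same number of steps.\<close>

definition asymptotic_to :: "'a \<Rightarrow> nat \<Rightarrow> 'a \<Rightarrow> bool" where
  "asymptotic_to p M u \<longleftrightarrow> (\<lambda>k. dist ((f ^^ (M + k)) u) ((f ^^ k) p)) \<longlonglongrightarrow> 0"

text \<open>A chain ending at \<open>p\<close>, continued by the exact orbit of \<open>p\<close>, is a limit-pseudo orbit. The convergence of
the shadowing error makes the shadowing point asymptotic to \<open>p\<close>. This is where s-limit shadowing gives
more than ordinary shadowing: the shadowing point can be led back to \<open>p\<close> by chains of any accuracy,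
not only of the accuracy of the chain that was shadowed.\<close>

lemma finite_chain_shadowing:
  assumes "0 < \<epsilon>"
  obtains \<delta> where "0 < \<delta>" "\<And>c M p. \<lbrakk>\<And>k. k < M \<Longrightarrow> (c k, c (Suc k)) \<in> step \<delta>; c M = p; p \<in> X\<rbrakk>
      \<Longrightarrow> \<exists>v\<in>X. (\<forall>k\<le>M. dist ((f ^^ k) v) (c k) \<le> \<epsilon>) \<and> asymptotic_to p M v"
proof -
  obtain \<delta> where "0 < \<delta>"
    and \<delta>: "\<And>x. limit_pseudo_orbit X f \<delta> x \<Longrightarrow> \<exists>v\<in>X. limit_shadowed f \<epsilon> x v"
    using limit_shadowing assms unfolding s_limit_shadowing_def by blast
  show thesis
  proof (rule that[OF \<open>0 < \<delta>\<close>])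
    fix c M p
    assume c: "\<And>k. k < M \<Longrightarrow> (c k, c (Suc k)) \<in> step \<delta>" and cM: "c M = p" and p: "p \<in> X"
    define x where "x = splice M c (\<lambda>k. (f ^^ k) p)"
    have x_left: "x k = c k" if "k \<le> M" for k
      using that cM by (auto simp: x_def splice_left)
    have x_right: "x (M + k) = (f ^^ k) p" for k by (simp add: x_def splice_right)
    have x_X: "x k \<in> X" for k
    proof (cases "k < M")
      case True
      then show ?thesis using c x_left[of k] by (auto simp: step_rel_def)
    next
      case False
      then show ?thesis using x_right[of "k - M"] iterate_in[OF p] by simp
    qed
    have exact: "dist (f (x k)) (x (Suc k)) = 0" if "k \<ge> M" for k
      using that x_right[of "k - M"] x_right[of "Suc (k - M)"] by simp
    have "limit_pseudo_orbit X f \<delta> x"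
      unfolding limit_pseudo_orbit_def
    proof (intro conjI allI)
      show "dist (f (x i)) (x (Suc i)) \<le> \<delta>" for i
      proof (cases "i < M")
        case True
        then show ?thesis using c[of i] x_left[of i] x_left[of "Suc i"] by (auto simp: step_rel_def)
      next
        case False
        then show ?thesis using exact[of i] \<open>0 < \<delta>\<close> by simp
      qed
      show "(\<lambda>i. dist (f (x i)) (x (Suc i))) \<longlonglongrightarrow> 0"
        by (rule tendsto_eventually, rule eventually_mono[OF eventually_ge_at_top[of M] exact])
    qed (rule x_X)
    then obtain v where v: "v \<in> X" "limit_shadowed f \<epsilon> x v" using \<delta> by blast
    have "\<forall>k\<le>M. dist ((f ^^ k) v) (c k) \<le> \<epsilon>"
      using v(2) x_left unfolding limit_shadowed_def by metis
    moreover have "asymptotic_to p M v"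
    proof -
      have "(\<lambda>k. dist ((f ^^ (k + M)) v) (x (k + M))) \<longlonglongrightarrow> 0"
        using v(2) LIMSEQ_ignore_initial_segment unfolding limit_shadowed_def by blast
      then show ?thesis by (simp add: asymptotic_to_def x_right add.commute[of _ M])
    qed
    ultimately show "\<exists>v\<in>X. (\<forall>k\<le>M. dist ((f ^^ k) v) (c k) \<le> \<epsilon>) \<and> asymptotic_to p M v"
      using v(1) by blast
  qed
qed

text \<open>Because all points of \<open>Q\<close> have the same delay \<open>M\<close>, they jump to the orbit of \<open>p\<close> at the same place, and one
chain from there back to \<open>p\<close> serves them all.\<close>

lemma asymptotic_return:
  assumes "finite Q" "Q \<subseteq> X" "p \<in> X" and asym: "\<And>u. u \<in> Q \<Longrightarrow> asymptotic_to p M u" and "0 < \<delta>"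
  shows "\<exists>K\<ge>N. \<exists>m. \<forall>u\<in>Q. ((f ^^ K) u, p) \<in> step \<delta> ^^ m"
proof -
  have "\<forall>\<^sub>F k in sequentially. \<forall>u\<in>Q. dist ((f ^^ (M + k)) u) ((f ^^ k) p) < \<delta>"
    using order_tendstoD(2)[OF asym[unfolded asymptotic_to_def] \<open>0 < \<delta>\<close>]
    by (intro eventually_ball_finite[OF \<open>finite Q\<close>]) blast
  then obtain k0 where k0: "\<And>k u. k \<ge> k0 \<Longrightarrow> u \<in> Q \<Longrightarrow> dist ((f ^^ (M + k)) u) ((f ^^ k) p) < \<delta>"
    unfolding eventually_sequentially by blast
  define k where "k = max k0 N"
  have "linked X f {()} (\<lambda>_. (f ^^ Suc k) p) (\<lambda>_. p)"
    using \<open>p \<in> X\<close> by (intro linked_sym[OF _ orbit_linked[of "{()}" "\<lambda>_. p" "Suc k"]]) auto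
  then obtain m where m: "((f ^^ Suc k) p, p) \<in> step \<delta> ^^ m"
    using \<open>0 < \<delta>\<close> unfolding linked_def by auto
  have "((f ^^ (M + k)) u, p) \<in> step \<delta> ^^ Suc m" if u: "u \<in> Q" for u
  proof (rule relpow_Suc_I2[OF _ m])
    have "dist ((f ^^ (M + Suc k)) u) ((f ^^ Suc k) p) < \<delta>"
      using k0[of "Suc k" u] u by (simp add: k_def)
    then show "((f ^^ (M + k)) u, (f ^^ Suc k) p) \<in> step \<delta>"
      using u assms(2,3) iterate_in[of u "M + k"] iterate_in[of p "Suc k"] by (auto simp: step_rel_def)
  qed
  moreover have "N \<le> M + k" by (simp add: k_def)
  ultimately show ?thesis by blast
qed

lemma asymptotic_linked:
  assumes "finite I" "\<And>i. i \<in> I \<Longrightarrow> u i \<in> X" "p \<in> X" "\<And>i. i \<in> I \<Longrightarrow> asymptotic_to p M (u i)"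
  shows "linked X f I u (\<lambda>_. p)"
  unfolding linked_def
proof (intro allI impI)
  fix \<delta> :: real assume "0 < \<delta>"
  obtain K m where Km: "\<forall>v\<in>u ` I. ((f ^^ K) v, p) \<in> step \<delta> ^^ m"
    using asymptotic_return[of "u ` I" p M \<delta> 0] assms \<open>0 < \<delta>\<close> by auto
  have "(u i, p) \<in> step \<delta> ^^ (K + m)" if "i \<in> I" for i
    using relpow_trans[OF orbit_chain[of "u i" \<delta> K]] Km that assms(2) \<open>0 < \<delta>\<close> by auto
  then show "\<exists>m. \<forall>i\<in>I. (u i, p) \<in> step \<delta> ^^ m" by blast
qed

section \<open>Tuples of orbits that stay apart\<close>

text \<open>Chains from a splitting point \<open>p\<close> to \<open>a\<close> and \<open>b\<close> and back form two loops of the same length \<open>m\<close>. Strand \<open>i\<close>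
repeats a word of \<open>n + 1\<close> loops whose \<open>i\<close>-th letter is the loop through \<open>b\<close> and whose other letters are
the loop through \<open>a\<close>. In every period two different strands are far apart at least once, so by uniform
continuity they are apart by some \<open>\<eta>\<close> all the time. Following \<open>T\<close> periods and then the orbit of \<open>p\<close>, the
shadowing points \<open>u T i\<close> are linked with \<open>p\<close>; the tuple \<open>z\<close> is a limit for \<open>T \<rightarrow> \<infinity>\<close>, which
keeps the links and is separated for all times.\<close>

lemma separated_tuple:
  fixes n :: nat
  assumes X: "p \<in> X" and "a \<noteq> b"
    and split: "\<forall>\<delta>>0. \<exists>m. (p, a) \<in> step \<delta> ^^ m \<and> (p, b) \<in> step \<delta> ^^ m"
  shows "\<exists>z \<eta>. 0 < \<eta> \<and> (\<forall>i. z i \<in> X) \<and> linked X f {..n} (\<lambda>_. p) z \<and>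
    (\<forall>i\<le>n. \<forall>j\<le>n. i \<noteq> j \<longrightarrow> (\<forall>k. \<eta> \<le> dist ((f ^^ k) (z i)) ((f ^^ k) (z j))))"
proof -
  define \<epsilon> where "\<epsilon> = dist a b / 4"
  have "0 < \<epsilon>" using \<open>a \<noteq> b\<close> by (simp add: \<epsilon>_def)
  obtain \<delta> where "0 < \<delta>"
    and \<delta>: "\<And>c M p. \<lbrakk>\<And>k. k < M \<Longrightarrow> (c k, c (Suc k)) \<in> step \<delta>; c M = p; p \<in> X\<rbrakk>
      \<Longrightarrow> \<exists>v\<in>X. (\<forall>k\<le>M. dist ((f ^^ k) v) (c k) \<le> \<epsilon>) \<and> asymptotic_to p M v"
    using finite_chain_shadowing[OF \<open>0 < \<epsilon>\<close>] by blast
  define ab where "ab s = (if s then b else a)" for s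
  have out: "linked X f UNIV (\<lambda>_. p) ab"
    using split unfolding linked_def ab_def by auto
  obtain m1 where m1: "\<And>s. (p, ab s) \<in> step \<delta> ^^ m1"
    using out \<open>0 < \<delta>\<close> unfolding linked_def by auto
  obtain m2 where m2: "\<And>s. (ab s, p) \<in> step \<delta> ^^ m2"
    using linked_sym[OF _ out] \<open>0 < \<delta>\<close> unfolding linked_def by auto
  have "m2 \<noteq> 0"
  proof
    assume "m2 = 0"
    then have "ab True = p" "ab False = p" using m2 by auto
    then show False using \<open>a \<noteq> b\<close> by (simp add: ab_def)
  qed
  obtain c1 where c1: "\<And>s. c1 s 0 = p" "\<And>s. c1 s m1 = ab s" "\<And>s k. k < m1 \<Longrightarrow> (c1 s k, c1 s (Suc k)) \<in> step \<delta>"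
    using m1 unfolding relpow_fun_conv by metis
  obtain c2 where c2: "\<And>s. c2 s 0 = ab s" "\<And>s. c2 s m2 = p" "\<And>s k. k < m2 \<Longrightarrow> (c2 s k, c2 s (Suc k)) \<in> step \<delta>"
    using m2 unfolding relpow_fun_conv by metis
  define m where "m = m1 + m2"
  have m: "m1 < m" "0 < m" using \<open>m2 \<noteq> 0\<close> by (auto simp: m_def)
  define g where "g s = splice m1 (c1 s) (c2 s)" for s
  have g_left: "g s k = c1 s k" if "k \<le> m1" for s k
    using that c1(2) c2(1) by (simp add: g_def splice_left)
  have g_step: "(g s k, g s (Suc k)) \<in> step \<delta>" if "k < m" for s k
    unfolding g_def by (rule splice_chain[of m1 _ _ m2]) (use c1 c2 that in \<open>auto simp: m_def\<close>)
  have g: "g s 0 = p" "g s m = p" "g s m1 = ab s" for s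
    using g_left c1 c2(2) by (auto simp: g_def m_def splice_right)
  define q where "q = Suc n"
  define w where "w i k = g (k div m mod q = i) (k mod m)" for i k
  have w_chain: "(w i k, w i (Suc k)) \<in> step \<delta>" for i k
  proof (cases "Suc (k mod m) = m")
    case True
    then have "w i (Suc k) = p" using g(1) by (simp add: w_def mod_Suc)
    moreover have "(w i k, g (k div m mod q = i) (Suc (k mod m))) \<in> step \<delta>"
      using g_step m by (simp add: w_def)
    ultimately show ?thesis unfolding True g(2) by simp
  next
    case False
    then have "w i (Suc k) = g (k div m mod q = i) (Suc (k mod m))"
      by (simp add: w_def mod_Suc div_Suc)
    then show ?thesis using g_step m by (simp add: w_def)
  qed
  have "w i (T * q * m) = p" for i T by (simp add: w_def g(1))
  then have "\<exists>v\<in>X. (\<forall>k\<le>T * q * m. dist ((f ^^ k) v) (w i k) \<le> \<epsilon>) \<and> asymptotic_to p (T * q * m) v" for T i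
    using \<delta>[of "T * q * m" "w i" p] w_chain X by blast
  then obtain u where u: "\<And>T i. u T i \<in> X" "\<And>T i. asymptotic_to p (T * q * m) (u T i)"
      "\<And>T i k. k \<le> T * q * m \<Longrightarrow> dist ((f ^^ k) (u T i)) (w i k) \<le> \<epsilon>"
    by metis
  have "0 < dist a b / 2" using \<open>a \<noteq> b\<close> by simp
  then obtain \<eta> where "0 < \<eta>" and \<eta>: "\<And>x y k. \<lbrakk>x \<in> X; y \<in> X; dist x y < \<eta>; k \<le> 2 * (q * m)\<rbrakk>
      \<Longrightarrow> dist ((f ^^ k) x) ((f ^^ k) y) < dist a b / 2"
    using modulus[of "dist a b / 2" "2 * (q * m)"] by blast
  have sep: "\<eta> \<le> dist ((f ^^ k) (u T i)) ((f ^^ k) (u T j))"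
    if ij: "i \<le> n" "j \<le> n" "i \<noteq> j" and T: "k + 2 \<le> T" for i j k T
  proof (rule ccontr)
    assume close: "\<not> ?thesis"
    \<comment> \<open>A time in the period after that of \<open>k\<close>: at \<open>\<tau>\<close> strand \<open>i\<close> is at \<open>b\<close> and strand \<open>j\<close> is at \<open>a\<close>.\<close>
    define \<tau> where "\<tau> = (q * (k div (q * m) + 1) + i) * m + m1"
    have \<tau>: "\<tau> div m = q * (k div (q * m) + 1) + i" "\<tau> mod m = m1" using m by (auto simp: \<tau>_def)
    have "\<tau> div m mod q = i"
      using ij(1) unfolding \<tau>(1) by (simp only: mod_mult_self4) (simp add: q_def)
    then have w: "w i \<tau> = b" "w j \<tau> = a" using ij(3) \<tau>(2) by (auto simp: w_def g(3) ab_def)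
    have qm: "0 < q * m" using m by (simp add: q_def)
    have "k < (k div (q * m) + 1) * (q * m)"
      using dividend_less_div_times[OF qm, of k] by (simp add: algebra_simps)
    also have "\<dots> \<le> \<tau>" by (simp add: \<tau>_def algebra_simps)
    finally have "k \<le> \<tau>" by simp
    have "i * m + m1 \<le> q * m"
      using add_mono[OF mult_le_mono1[OF ij(1), of m] less_imp_le[OF m(1)]] by (simp add: q_def)
    then have \<tau>_le: "\<tau> \<le> (k div (q * m)) * (q * m) + 2 * (q * m)" by (simp add: \<tau>_def algebra_simps)
    also have "\<dots> \<le> k + 2 * (q * m)" by simp
    finally have lag: "\<tau> - k \<le> 2 * (q * m)" by simp
    have "\<tau> \<le> (k div (q * m) + 2) * (q * m)" using \<tau>_le by (simp add: algebra_simps)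
    also have "\<dots> \<le> T * (q * m)"
      using T div_le_dividend[of k "q * m"] by (intro mult_le_mono1) linarith
    finally have "\<tau> \<le> T * q * m" by (simp add: mult.assoc)
    then have near: "dist ((f ^^ \<tau>) (u T i)) b \<le> \<epsilon>" "dist ((f ^^ \<tau>) (u T j)) a \<le> \<epsilon>"
      using u(3)[of \<tau> T i] u(3)[of \<tau> T j] w by auto
    have "dist ((f ^^ (\<tau> - k)) ((f ^^ k) (u T i))) ((f ^^ (\<tau> - k)) ((f ^^ k) (u T j))) < dist a b / 2"
      using close lag u(1) by (intro \<eta>) (auto intro: iterate_in)
    moreover have "(f ^^ (\<tau> - k)) ((f ^^ k) x) = (f ^^ \<tau>) x" for x
      using \<open>k \<le> \<tau>\<close> by (metis comp_apply funpow_add le_add_diff_inverse2)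
    ultimately have "dist ((f ^^ \<tau>) (u T i)) ((f ^^ \<tau>) (u T j)) < dist a b / 2" by simp
    then show False
      using near dist_triangle3[of a b "(f ^^ \<tau>) (u T j)"]
        dist_triangle[of "(f ^^ \<tau>) (u T j)" b "(f ^^ \<tau>) (u T i)"]
      by (simp add: \<epsilon>_def dist_commute)
  qed
  obtain z r where z: "strict_mono r" "\<And>i. z i \<in> X" "\<And>i. (\<lambda>t. u (r t) i) \<longlonglongrightarrow> z i"
    by (rule convergent_tuple_subsequence[OF compact, of u]) (use u(1) in auto)
  have "linked X f {..n} (\<lambda>_. p) z"
  proof (rule linked_closed)
    fix e :: real assume "0 < e"
    have "\<forall>\<^sub>F t in sequentially. \<forall>i\<in>{..n}. dist (u (r t) i) (z i) < e"
      using z(3) \<open>0 < e\<close> by (intro eventually_ball_finite) (auto dest: tendstoD)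
    from eventually_happens'[OF sequentially_bot this]
    obtain t where t: "\<forall>i\<in>{..n}. dist (u (r t) i) (z i) < e" by (elim exE)
    moreover have "linked X f {..n} (\<lambda>_. p) (u (r t))"
      by (intro linked_sym[OF _ asymptotic_linked[where M = "r t * q * m"]] finite_atMost u(1,2) X)
    ultimately show "\<exists>y'. linked X f {..n} (\<lambda>_. p) y' \<and> (\<forall>i\<in>{..n}. y' i \<in> X \<and> dist (y' i) (z i) \<le> e)"
      by (intro exI[of _ "u (r t)"] conjI ballI u(1)) (use t in \<open>auto intro: less_imp_le\<close>)
  qed (use z in auto)
  moreover have "\<eta> \<le> dist ((f ^^ k) (z i)) ((f ^^ k) (z j))" if ij: "i \<le> n" "j \<le> n" "i \<noteq> j" for i j k
  proof (rule LIMSEQ_le_const)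
    have "(\<lambda>t. (f ^^ k) (u (r t) i)) \<longlonglongrightarrow> (f ^^ k) (z i)" for i
      using continuous_on_tendsto_compose[OF iterate_continuous z(3) z(2)] u(1) by simp
    then show "(\<lambda>t. dist ((f ^^ k) (u (r t) i)) ((f ^^ k) (u (r t) j))) \<longlonglongrightarrow> dist ((f ^^ k) (z i)) ((f ^^ k) (z j))"
      by (intro tendsto_dist)
    show "\<exists>N. \<forall>t\<ge>N. \<eta> \<le> dist ((f ^^ k) (u (r t) i)) ((f ^^ k) (u (r t) j))"
      using sep[OF ij] order_trans[OF _ seq_suble[OF z(1)]] by blast
  qed
  ultimately show ?thesis using \<open>0 < \<eta>\<close> z(2) by blast
qed

section \<open>Continuous families of points with prescribed itineraries\<close>

text \<open>The pseudo-orbit follows \<open>u\<close> until it is about to merge with \<open>p\<close>, returns to \<open>p\<close>, goes from \<open>p\<close> to \<open>z i\<close>,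
follows the orbit of \<open>z i\<close> for \<open>R * B\<close> steps, and returns to \<open>p\<close>. The beginning \<open>B\<close> of this window is
common to all \<open>u\<close> and \<open>i\<close>, and it is known before the length of the window is chosen; so the window can
be made as dominant as desired. The new points are again asymptotic to \<open>p\<close>, and the step can be iterated.\<close>

lemma extend_by_window:
  assumes "p \<in> X" and Q: "finite Q" "Q \<subseteq> X" "\<forall>u\<in>Q. asymptotic_to p M u"
    and I: "finite I" "z ` I \<subseteq> X" "linked X f I (\<lambda>_. p) z" and "0 < \<epsilon>"
  shows "\<exists>g M' B. N < B \<and> (\<forall>u\<in>Q. \<forall>i\<in>I. g u i \<in> X \<and> asymptotic_to p M' (g u i) \<and>
      (\<forall>k\<le>N. dist ((f ^^ k) (g u i)) ((f ^^ k) u) \<le> \<epsilon>) \<and>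
      (\<forall>k\<le>R * B. dist ((f ^^ (B + k)) (g u i)) ((f ^^ k) (z i)) \<le> \<epsilon>))"
proof -
  obtain \<delta> where "0 < \<delta>"
    and \<delta>: "\<And>c M p. \<lbrakk>\<And>k. k < M \<Longrightarrow> (c k, c (Suc k)) \<in> step \<delta>; c M = p; p \<in> X\<rbrakk>
      \<Longrightarrow> \<exists>v\<in>X. (\<forall>k\<le>M. dist ((f ^^ k) v) (c k) \<le> \<epsilon>) \<and> asymptotic_to p M v"
    using finite_chain_shadowing[OF \<open>0 < \<epsilon>\<close>] by blast
  obtain K m1 where K: "Suc N \<le> K" and m1: "\<forall>u\<in>Q. ((f ^^ K) u, p) \<in> step \<delta> ^^ m1"
    using asymptotic_return[OF Q(1,2) \<open>p \<in> X\<close> Q(3)[rule_format] \<open>0 < \<delta>\<close>] by blast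
  obtain m2 where m2: "\<forall>i\<in>I. (p, z i) \<in> step \<delta> ^^ m2"
    using I(3) \<open>0 < \<delta>\<close> unfolding linked_def by blast
  define m where "m = m1 + m2"
  define B where "B = K + m"
  define L where "L = R * B"
  have "linked X f I (\<lambda>_. p) (\<lambda>i. (f ^^ L) (z i))"
    using I by (intro linked_trans[OF I(3)] orbit_linked) auto
  then have "linked X f I (\<lambda>i. (f ^^ L) (z i)) (\<lambda>_. p)" by (rule linked_sym[OF I(1)])
  then obtain m3 where m3: "\<forall>i\<in>I. ((f ^^ L) (z i), p) \<in> step \<delta> ^^ m3"
    using \<open>0 < \<delta>\<close> unfolding linked_def by blast
  define M' where "M' = K + (m + (L + m3))"
  have orbit_step: "((f ^^ k) x, (f ^^ Suc k) x) \<in> step \<delta>" if "x \<in> X" for x k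
    using that \<open>0 < \<delta>\<close> iterate_in[of x k] iterate_in[of x "Suc k"] by (simp add: step_rel_def)
  have "\<exists>v\<in>X. asymptotic_to p M' v \<and> (\<forall>k\<le>N. dist ((f ^^ k) v) ((f ^^ k) u) \<le> \<epsilon>) \<and>
      (\<forall>k\<le>L. dist ((f ^^ (B + k)) v) ((f ^^ k) (z i)) \<le> \<epsilon>)" if u: "u \<in> Q" and i: "i \<in> I" for u i
  proof -
    have "((f ^^ K) u, z i) \<in> step \<delta> ^^ m"
      unfolding m_def using m1 m2 u i by (blast intro: relpow_trans)
    then obtain c1 where c1: "c1 0 = (f ^^ K) u" "c1 m = z i" "\<And>k. k < m \<Longrightarrow> (c1 k, c1 (Suc k)) \<in> step \<delta>"
      unfolding relpow_fun_conv by blast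
    obtain c3 where c3: "c3 0 = (f ^^ L) (z i)" "c3 m3 = p" "\<And>k. k < m3 \<Longrightarrow> (c3 k, c3 (Suc k)) \<in> step \<delta>"
      using m3 i unfolding relpow_fun_conv by blast
    define d2 where "d2 = splice L (\<lambda>k. (f ^^ k) (z i)) c3"
    define d1 where "d1 = splice m c1 d2"
    define c where "c = splice K (\<lambda>k. (f ^^ k) u) d1"
    have d2_left: "d2 k = (f ^^ k) (z i)" if "k \<le> L" for k
      using that c3(1) by (simp add: d2_def splice_left)
    have d2_chain: "(d2 k, d2 (Suc k)) \<in> step \<delta>" if "k < L + m3" for k
      unfolding d2_def using orbit_step[of "z i"] I(2) i c3 that by (intro splice_chain) auto
    have "c1 m = d2 0" using c1(2) d2_left[of 0] by simp
    then have d1_0: "d1 0 = (f ^^ K) u" using c1(1) splice_left[of c1 m d2 0] by (simp add: d1_def)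
    have d1_chain: "(d1 k, d1 (Suc k)) \<in> step \<delta>" if "k < m + (L + m3)" for k
      unfolding d1_def using \<open>c1 m = d2 0\<close> c1(3) d2_chain that by (intro splice_chain[of m]) auto
    have c_chain: "(c k, c (Suc k)) \<in> step \<delta>" if "k < M'" for k
      unfolding c_def using orbit_step[of u] u Q(2) d1_0 d1_chain that
      by (intro splice_chain[of K _ _ "m + (L + m3)"]) (auto simp: M'_def)
    have c_end: "c M' = p"
      using c3(2) by (simp add: c_def d1_def d2_def M'_def splice_right)
    have c_left: "c k = (f ^^ k) u" if "k \<le> K" for k
      using that d1_0 by (simp add: c_def splice_left)
    have c_window: "c (B + k) = (f ^^ k) (z i)" if "k \<le> L" for k
      using d2_left[OF that] by (simp add: c_def d1_def B_def splice_right add.assoc)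
    obtain v where v: "v \<in> X" "\<forall>k\<le>M'. dist ((f ^^ k) v) (c k) \<le> \<epsilon>" "asymptotic_to p M' v"
      using \<delta>[OF c_chain c_end \<open>p \<in> X\<close>] by blast
    have "dist ((f ^^ k) v) ((f ^^ k) u) \<le> \<epsilon>" if "k \<le> N" for k
      using v(2)[rule_format, of k] c_left[of k] that K by (simp add: M'_def)
    moreover have "dist ((f ^^ (B + k)) v) ((f ^^ k) (z i)) \<le> \<epsilon>" if "k \<le> L" for k
      using v(2)[rule_format, of "B + k"] c_window[OF that] that by (simp add: M'_def B_def)
    ultimately show ?thesis using v by blast
  qed
  then obtain g where "\<forall>u\<in>Q. \<forall>i\<in>I. g u i \<in> X \<and> asymptotic_to p M' (g u i) \<and>
      (\<forall>k\<le>N. dist ((f ^^ k) (g u i)) ((f ^^ k) u) \<le> \<epsilon>) \<and>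
      (\<forall>k\<le>L. dist ((f ^^ (B + k)) (g u i)) ((f ^^ k) (z i)) \<le> \<epsilon>)" by metis
  moreover have "N < B" using K by (simp add: B_def)
  ultimately show ?thesis unfolding L_def by blast
qed

text \<open>Iteration of the previous lemma with errors \<open>1 / 2 ^ s\<close>. Shadowing points are not unique and need not
depend continuously on the pseudo-orbit. Continuity of \<open>\<Phi>\<close> comes from the approximations \<open>q s\<close> instead:
each of them is locally constant, being a function of the preceding one and of the label \<open>c s\<close>, and they
converge uniformly. Their ranges are finite, so that all points of a stage can share the same times. A stage
perturbs the earlier windows by at most its own error.\<close>

lemma tracking_map:
  fixes I :: "nat \<Rightarrow> 'i set" and z :: "nat \<Rightarrow> 'i \<Rightarrow> 'a" and c :: "nat \<Rightarrow> 'b::topological_space \<Rightarrow> 'i"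
  assumes "p \<in> X" and I: "\<And>s. finite (I s)" "\<And>s. z s ` I s \<subseteq> X"
      "\<And>s. linked X f (I s) (\<lambda>_. p) (z s)"
    and c: "\<And>s b. c s b \<in> I s" "\<And>s b. \<forall>\<^sub>F b' in nhds b. c s b' = c s b"
  obtains \<Phi> B where "continuous_on UNIV \<Phi>" "range \<Phi> \<subseteq> X" "\<And>s. s \<le> B s"
    "\<And>s b k. k \<le> s * B s \<Longrightarrow>
      dist ((f ^^ (B s + k)) (\<Phi> b)) ((f ^^ k) (z s (c s b))) \<le> 2 / 2 ^ s"
proof -
  define good where "good M q \<longleftrightarrow> finite (range q) \<and> range q \<subseteq> X \<and>
      (\<forall>b. asymptotic_to p M (q b)) \<and> (\<forall>b. \<forall>\<^sub>F b' in nhds b. q b' = q b)" for M and q :: "'b \<Rightarrow> 'a"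
  define window where "window s B q \<longleftrightarrow> s \<le> B \<and>
      (\<forall>b. \<forall>k\<le>s * B. dist ((f ^^ (B + k)) (q b)) ((f ^^ k) (z s (c s b))) \<le> 1 / 2 ^ s)" for s B q
  have extend: "\<exists>q' M' B. good M' q' \<and> window s B q' \<and> N < B \<and>
      (\<forall>b. \<forall>k\<le>N. dist ((f ^^ k) (q' b)) ((f ^^ k) (q b)) \<le> 1 / 2 ^ s)"
    if q: "good M q" and "s \<le> Suc N" for q M s N
  proof -
    have "(0::real) < 1 / 2 ^ s" by simp
    have range_q: "finite (range q)" "range q \<subseteq> X" "\<forall>u\<in>range q. asymptotic_to p M u"
      using q by (auto simp: good_def)
    from extend_by_window[OF \<open>p \<in> X\<close> range_q I(1)[of s] I(2)[of s] I(3)[of s] \<open>0 < 1 / 2 ^ s\<close>, where N = N and R = s]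
    obtain g M' B where g: "N < B" "\<forall>u\<in>range q. \<forall>i\<in>I s. g u i \<in> X \<and> asymptotic_to p M' (g u i) \<and>
      (\<forall>k\<le>N. dist ((f ^^ k) (g u i)) ((f ^^ k) u) \<le> 1 / 2 ^ s) \<and>
      (\<forall>k\<le>s * B. dist ((f ^^ (B + k)) (g u i)) ((f ^^ k) (z s i)) \<le> 1 / 2 ^ s)"
      by (elim exE conjE)
    define q' where "q' b = g (q b) (c s b)" for b
    have "range q' \<subseteq> (\<lambda>(u, i). g u i) ` (range q \<times> I s)"
      using c(1) by (auto simp: q'_def)
    then have "finite (range q')"
      by (rule finite_subset) (use q I(1) in \<open>auto simp: good_def\<close>)
    moreover have "\<forall>\<^sub>F b' in nhds b. q' b' = q' b" for b
    proof -
      have "\<forall>\<^sub>F b' in nhds b. q b' = q b" using q by (simp add: good_def)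
      then show ?thesis using c(2)[of s b] by eventually_elim (simp add: q'_def)
    qed
    ultimately have "good M' q'"
      using g(2) c(1) unfolding good_def q'_def by blast
    moreover have "window s B q'"
      using g c(1) \<open>s \<le> Suc N\<close> unfolding window_def q'_def by auto
    moreover have "\<forall>b. \<forall>k\<le>N. dist ((f ^^ k) (q' b)) ((f ^^ k) (q b)) \<le> 1 / 2 ^ s"
      using g(2) c(1) unfolding q'_def by blast
    ultimately show ?thesis using g(1) by blast
  qed
  \<comment> \<open>A state consists of an approximation, its common delay relative to \<open>p\<close> and the beginning of its window.\<close>
  have "\<exists>st. \<forall>s. (case st s of (q, M, B) \<Rightarrow> good M q \<and> window s B q) \<and>
      (case st s of (q, M, B) \<Rightarrow> case st (Suc s) of (q', M', B') \<Rightarrow> B + s * B < B' \<and>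
        (\<forall>b. \<forall>k\<le>B + s * B. dist ((f ^^ k) (q' b)) ((f ^^ k) (q b)) \<le> 1 / 2 ^ Suc s))"
  proof (rule dependent_nat_choice)
    have "good 0 (\<lambda>_. p)" using \<open>p \<in> X\<close> by (auto simp: good_def asymptotic_to_def)
    then obtain q M B where "good M q" "window 0 B q" using extend[of 0 "\<lambda>_. p" 0 0] by auto
    then show "\<exists>st. case st of (q, M, B) \<Rightarrow> good M q \<and> window 0 B q" by auto
  next
    fix st s assume "case st of (q, M :: nat, B) \<Rightarrow> good M q \<and> window s B q"
    then obtain q M B where st: "st = (q, M, B)" "good M q" "window s B q" by (cases st) auto
    have "Suc s \<le> Suc (B + s * B)" using st(3) by (auto simp: window_def)
    then obtain q' M' B' where "good M' q'" "window (Suc s) B' q'" "B + s * B < B'"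
        "\<forall>b. \<forall>k\<le>B + s * B. dist ((f ^^ k) (q' b)) ((f ^^ k) (q b)) \<le> 1 / 2 ^ Suc s"
      using extend[OF st(2), of "Suc s" "B + s * B"] by blast
    then show "\<exists>st'. (case st' of (q, M, B) \<Rightarrow> good M q \<and> window (Suc s) B q) \<and>
      (case st of (q, M, B) \<Rightarrow> case st' of (q', M', B') \<Rightarrow> B + s * B < B' \<and>
        (\<forall>b. \<forall>k\<le>B + s * B. dist ((f ^^ k) (q' b)) ((f ^^ k) (q b)) \<le> 1 / 2 ^ Suc s))"
      by (intro exI[of _ "(q', M', B')"]) (simp add: st(1))
  qed
  then obtain st where st: "\<forall>s. (case st s of (q, M, B) \<Rightarrow> good M q \<and> window s B q) \<and>
      (case st s of (q, M, B) \<Rightarrow> case st (Suc s) of (q', M', B') \<Rightarrow> B + s * B < B' \<and>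
        (\<forall>b. \<forall>k\<le>B + s * B. dist ((f ^^ k) (q' b)) ((f ^^ k) (q b)) \<le> 1 / 2 ^ Suc s))"
    by (elim exE)
  define q where "q s = fst (st s)" for s
  define M where "M s = fst (snd (st s))" for s
  define B where "B s = snd (snd (st s))" for s
  define N where "N s = B s + s * B s" for s
  have q: "good (M s) (q s)" "window s (B s) (q s)" for s
    using spec[OF st, of s] by (auto simp: q_def M_def B_def split: prod.splits)
  have step: "N s < B (Suc s)"
      "k \<le> N s \<Longrightarrow> dist ((f ^^ k) (q (Suc s) b)) ((f ^^ k) (q s b)) \<le> 1 / 2 ^ Suc s" for s k b
    using spec[OF st, of s] by (auto simp: q_def B_def N_def split: prod.splits)
  have N_mono: "N s \<le> N (s + j)" for s j
  proof (induction j)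
    case (Suc j)
    then show ?case using step(1)[of "s + j"] by (simp add: N_def)
  qed simp
  have q_X: "q s b \<in> X" for s b using q(1)[of s] by (auto simp: good_def)
  \<comment> \<open>The bound on the right telescopes: stage \<open>s + j + 1\<close> adds \<open>1 / 2 ^ (s + j + 1)\<close>.\<close>
  have close: "dist ((f ^^ k) (q (s + j) b)) ((f ^^ k) (q s b)) \<le> 1 / 2 ^ s - 1 / 2 ^ (s + j)"
    if "k \<le> N s" for s j k b
  proof (induction j)
    case (Suc j)
    have "dist ((f ^^ k) (q (Suc (s + j)) b)) ((f ^^ k) (q (s + j) b)) \<le> 1 / 2 ^ Suc (s + j)"
      using step(2) N_mono[of s j] that by (meson order_trans)
    then show ?case
      using Suc dist_triangle[of "(f ^^ k) (q (Suc (s + j)) b)" "(f ^^ k) (q s b)" "(f ^^ k) (q (s + j) b)"]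
      by simp
  qed simp
  have close': "dist ((f ^^ k) (q t b)) ((f ^^ k) (q s b)) \<le> 1 / 2 ^ s" if "k \<le> N s" "s \<le> t" for s t k b
  proof -
    have "dist ((f ^^ k) (q t b)) ((f ^^ k) (q s b)) \<le> 1 / 2 ^ s - 1 / 2 ^ t"
      using close[OF that(1), of "t - s" b] that(2) by simp
    also have "\<dots> \<le> 1 / 2 ^ s" by simp
    finally show ?thesis .
  qed
  have small: "\<exists>s. 2 / 2 ^ s < e" if "0 < e" for e :: real
    using real_arch_pow_inv[of "e / 2" "1 / 2"] that by (auto simp: power_one_over field_simps)
  have "\<exists>l\<in>X. (\<lambda>s. q s b) \<longlonglongrightarrow> l" for b
  proof -
    have "Cauchy (\<lambda>s. q s b)"
      unfolding Cauchy_altdef2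
    proof (intro allI impI)
      fix e :: real assume "0 < e"
      then obtain s where "2 / 2 ^ s < e" using small by blast
      moreover have "(1::real) / 2 ^ s \<le> 2 / 2 ^ s" by (simp add: divide_right_mono)
      ultimately have "dist (q n b) (q s b) < e" if "n \<ge> s" for n
        using close'[of 0 s n b] that by simp
      then show "\<exists>N. \<forall>n\<ge>N. dist (q n b) (q N b) < e" by (intro exI[of _ s]) simp
    qed
    then obtain l where "l \<in> X" "(\<lambda>s. q s b) \<longlonglongrightarrow> l"
      by (rule completeE[OF compact_imp_complete[OF compact], rotated]) (use q_X that in auto)
    then show ?thesis by blast
  qed
  then obtain \<Phi> where \<Phi>: "\<And>b. \<Phi> b \<in> X" "\<And>b. (\<lambda>s. q s b) \<longlonglongrightarrow> \<Phi> b" by metis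
  have \<Phi>_close: "dist ((f ^^ k) (\<Phi> b)) ((f ^^ k) (q s b)) \<le> 1 / 2 ^ s" if "k \<le> N s" for k s b
  proof (rule LIMSEQ_le_const2)
    have "(\<lambda>t. (f ^^ k) (q t b)) \<longlonglongrightarrow> (f ^^ k) (\<Phi> b)"
      using continuous_on_tendsto_compose[OF iterate_continuous \<Phi>(2,1)] q_X by simp
    then show "(\<lambda>t. dist ((f ^^ k) (q t b)) ((f ^^ k) (q s b))) \<longlonglongrightarrow> dist ((f ^^ k) (\<Phi> b)) ((f ^^ k) (q s b))"
      by (intro tendsto_dist tendsto_const)
    show "\<exists>N. \<forall>t\<ge>N. dist ((f ^^ k) (q t b)) ((f ^^ k) (q s b)) \<le> 1 / 2 ^ s"
      using close'[OF that] by blast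
  qed
  have "continuous_on UNIV \<Phi>"
    unfolding continuous_on_def
  proof (intro ballI tendstoI)
    fix b and e :: real assume "0 < e"
    then obtain s where s: "2 / 2 ^ s < e" using small by blast
    have "\<forall>\<^sub>F b' in nhds b. q s b' = q s b" using q(1) by (simp add: good_def)
    then have "\<forall>\<^sub>F b' in nhds b. dist (\<Phi> b') (\<Phi> b) < e"
    proof eventually_elim
      case (elim b')
      then show ?case
        using \<Phi>_close[of 0 s b'] \<Phi>_close[of 0 s b] dist_triangle2[of "\<Phi> b'" "\<Phi> b" "q s b"] s by simp
    qed
    then show "\<forall>\<^sub>F b' in at b within UNIV. dist (\<Phi> b') (\<Phi> b) < e"
      by (auto simp: eventually_at_filter elim: eventually_mono)
  qed
  moreover have "dist ((f ^^ (B s + k)) (\<Phi> b)) ((f ^^ k) (z s (c s b))) \<le> 2 / 2 ^ s"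
    if "k \<le> s * B s" for s b k
  proof -
    have "dist ((f ^^ (B s + k)) (q s b)) ((f ^^ k) (z s (c s b))) \<le> 1 / 2 ^ s"
      using q(2)[of s] that by (simp add: window_def)
    moreover have "dist ((f ^^ (B s + k)) (\<Phi> b)) ((f ^^ (B s + k)) (q s b)) \<le> 1 / 2 ^ s"
      using that by (intro \<Phi>_close) (simp add: N_def)
    ultimately show ?thesis
      using dist_triangle[of "(f ^^ (B s + k)) (\<Phi> b)" "(f ^^ k) (z s (c s b))" "(f ^^ (B s + k)) (q s b)"]
      by simp
  qed
  moreover have "s \<le> B s" for s using q(2)[of s] by (simp add: window_def)
  moreover have "range \<Phi> \<subseteq> X" using \<Phi>(1) by auto
  ultimately show thesis by (intro that[of \<Phi> B])
qed

end

section \<open>Upper density\<close>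

text \<open>The window \<open>[B s, (s + 1) * B s)\<close> occupies the fraction \<open>s / (s + 1)\<close> of the times before its end.\<close>

lemma limsup_density_eq_1:
  assumes "infinite A" and B: "\<And>s. s \<in> A \<Longrightarrow> s \<le> B s"
    and P: "\<And>s k. s \<in> A \<Longrightarrow> k \<le> s * B s \<Longrightarrow> P (B s + k)"
  shows "limsup (\<lambda>m. ereal (real (card {k. k < m \<and> P k}) / real m)) = 1"
proof (rule antisym)
  have "card {k. k < m \<and> P k} \<le> m" for m
    using card_mono[of "{..<m}" "{k. k < m \<and> P k}"] by auto
  then have "ereal (real (card {k. k < m \<and> P k}) / real m) \<le> 1" for m
    by (cases "m = 0") (auto simp: divide_le_eq one_ereal_def)
  then show "limsup (\<lambda>m. ereal (real (card {k. k < m \<and> P k}) / real m)) \<le> 1"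
    by (intro Limsup_bounded) auto
next
  show "1 \<le> limsup (\<lambda>m. ereal (real (card {k. k < m \<and> P k}) / real m))"
  proof (rule ccontr)
    assume "\<not> ?thesis"
    then have "limsup (\<lambda>m. ereal (real (card {k. k < m \<and> P k}) / real m)) < 1" by (simp add: not_le)
    from ereal_dense2[OF this] obtain r
      where r: "limsup (\<lambda>m. ereal (real (card {k. k < m \<and> P k}) / real m)) < ereal r" "r < 1"
      by (auto simp: one_ereal_def)
    obtain N where N: "\<And>m. m \<ge> N \<Longrightarrow> real (card {k. k < m \<and> P k}) / real m < r"
      using Limsup_lessD[OF r(1)] by (auto simp: eventually_sequentially)
    obtain s0 where s0: "inverse (real (Suc s0)) < 1 - r"
      using reals_Archimedean[of "1 - r"] r(2) by auto
    obtain s where s: "s \<in> A" "s \<ge> Suc (max N s0)"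
      using assms(1) by (meson infinite_nat_iff_unbounded_le)
    define m where "m = B s + s * B s"
    have "B s > 0" "N \<le> m" using B[OF s(1)] s(2) by (auto simp: m_def)
    have "{B s..<m} \<subseteq> {k. k < m \<and> P k}"
    proof
      fix k assume "k \<in> {B s..<m}"
      then show "k \<in> {k. k < m \<and> P k}" using P[OF s(1), of "k - B s"] by (auto simp: m_def)
    qed
    then have "card {B s..<m} \<le> card {k. k < m \<and> P k}" by (intro card_mono) auto
    then have "real s * real (B s) \<le> real (card {k. k < m \<and> P k})"
      by (simp add: m_def flip: of_nat_mult)
    then have ratio: "real s * real (B s) / real m \<le> real (card {k. k < m \<and> P k}) / real m"
      by (intro divide_right_mono) auto
    have "real m = real (Suc s) * real (B s)" by (simp add: m_def algebra_simps)
    then have "real s * real (B s) / real m = real s / real (Suc s)"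
      using \<open>B s > 0\<close> by simp
    also have "\<dots> = 1 - inverse (real (Suc s))" by (simp add: field_simps)
    finally have "real s * real (B s) / real m = 1 - inverse (real (Suc s))" .
    moreover have "inverse (real (Suc s)) \<le> inverse (real (Suc s0))"
      using s(2) by (intro le_imp_inverse_le) auto
    ultimately show False using ratio N[OF \<open>N \<le> m\<close>] s0 by linarith
  qed
qed

section \<open>Labels of binary sequences\<close>

text \<open>There are only countably many lists \<open>W\<close>, yet every finite family of sequences is separated by the labels
of some list. The empty list gives all sequences the same label.\<close>

definition label :: "bool list list \<Rightarrow> (nat \<Rightarrow> bool) \<Rightarrow> nat" where
  "label W \<alpha> = length (takeWhile (\<lambda>w. map \<alpha> [0..<length w] \<noteq> w) W)"

lemma label_le: "label W \<alpha> \<le> length W"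
  by (simp add: label_def length_takeWhile_le)

lemma label_locally_constant: "\<forall>\<^sub>F \<beta> in nhds \<alpha>. label W \<beta> = label W \<alpha>"
proof -
  have coord: "\<forall>\<^sub>F \<beta> in nhds \<alpha>. \<beta> i = \<alpha> i" for i
  proof -
    have "open ((\<lambda>\<beta>::nat \<Rightarrow> bool. \<beta> i) -` {\<alpha> i})"
      by (intro open_vimage open_discrete continuous_on_product_coordinates)
    then show ?thesis by (rule eventually_nhds_in_open[THEN eventually_mono]) auto
  qed
  have "\<forall>\<^sub>F \<beta> in nhds \<alpha>. \<forall>w\<in>set W. \<forall>i\<in>{..<length w}. \<beta> i = \<alpha> i"
    by (intro eventually_ball_finite ballI coord) auto
  then show ?thesis
  proof eventually_elim
    case (elim \<beta>)
    then have prefix: "map \<beta> [0..<length w] = map \<alpha> [0..<length w]" if "w \<in> set W" for w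
      using that by auto
    then have "takeWhile (\<lambda>w. map \<beta> [0..<length w] \<noteq> w) W = takeWhile (\<lambda>w. map \<alpha> [0..<length w] \<noteq> w) W"
      by (intro takeWhile_cong) (simp_all only: prefix)
    then show ?case by (simp add: label_def)
  qed
qed

lemma label_prefix:
  assumes "map \<alpha> [0..<l] \<in> set W" "\<forall>w\<in>set W. length w = l"
  shows "W ! label W \<alpha> = map \<alpha> [0..<l]"
proof -
  have "label W \<alpha> < length W"
  proof -
    let ?P = "\<lambda>w. map \<alpha> [0..<length w] \<noteq> w"
    have "0 < length (dropWhile ?P W)" using assms by auto
    moreover have "length (takeWhile ?P W) + length (dropWhile ?P W) = length W"
      unfolding length_append[symmetric] by simp
    ultimately show ?thesis unfolding label_def by linarith
  qed
  then have "map \<alpha> [0..<length (W ! label W \<alpha>)] = W ! label W \<alpha>"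
    unfolding label_def using nth_length_takeWhile by fastforce
  then show ?thesis using assms(2) \<open>label W \<alpha> < length W\<close> by auto
qed

lemma separating_prefix_length:
  assumes "finite A"
  shows "\<exists>l. inj_on (\<lambda>\<alpha>::nat \<Rightarrow> 'a. map \<alpha> [0..<l]) A"
proof -
  define D where "D = (\<lambda>(\<alpha>, \<beta>). LEAST k. \<alpha> k \<noteq> \<beta> k) ` (A \<times> A)"
  obtain l where l: "\<forall>d\<in>D. d < l"
    using assms finite_nat_set_iff_bounded[of D] by (auto simp: D_def)
  have "inj_on (\<lambda>\<alpha>. map \<alpha> [0..<l]) A"
  proof (rule inj_onI, rule ccontr)
    fix \<alpha> \<beta> assume *: "\<alpha> \<in> A" "\<beta> \<in> A" "map \<alpha> [0..<l] = map \<beta> [0..<l]" "\<alpha> \<noteq> \<beta>"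
    then obtain k where "\<alpha> k \<noteq> \<beta> k" by (auto simp: fun_eq_iff)
    then have "\<alpha> (LEAST k. \<alpha> k \<noteq> \<beta> k) \<noteq> \<beta> (LEAST k. \<alpha> k \<noteq> \<beta> k)"
      by (rule LeastI)
    moreover have "(LEAST k. \<alpha> k \<noteq> \<beta> k) < l" using l *(1,2) by (auto simp: D_def)
    ultimately show False using *(3) by auto
  qed
  then show ?thesis by blast
qed

section \<open>Scrambled Cantor sets\<close>

lemma pair_dists_bounds:
  assumes "n \<ge> 2"
  shows "Max (pair_dists n y) < \<epsilon> \<longleftrightarrow> (\<forall>i j. 1 \<le> i \<and> i < j \<and> j \<le> n \<longrightarrow> dist (y i) (y j) < \<epsilon>)"
    and "Min (pair_dists n y) > \<epsilon> \<longleftrightarrow> (\<forall>i j. 1 \<le> i \<and> i < j \<and> j \<le> n \<longrightarrow> dist (y i) (y j) > \<epsilon>)"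
proof -
  have "pair_dists n y \<subseteq> (\<lambda>(i, j). dist (y i) (y j)) ` ({1..n} \<times> {1..n})"
    by (auto simp: pair_dists_def)
  then have "finite (pair_dists n y)" by (rule finite_subset) auto
  moreover have "dist (y 1) (y 2) \<in> pair_dists n y" using assms by (force simp: pair_dists_def)
  ultimately show "Max (pair_dists n y) < \<epsilon> \<longleftrightarrow> (\<forall>i j. 1 \<le> i \<and> i < j \<and> j \<le> n \<longrightarrow> dist (y i) (y j) < \<epsilon>)"
    "Min (pair_dists n y) > \<epsilon> \<longleftrightarrow> (\<forall>i j. 1 \<le> i \<and> i < j \<and> j \<le> n \<longrightarrow> dist (y i) (y j) > \<epsilon>)"
    by (subst Max_less_iff Min_gr_iff; auto simp: pair_dists_def)+
qed

lemma compact_bool_sequences: "compact (UNIV :: (nat \<Rightarrow> bool) set)"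
proof -
  have "compact (UNIV :: bool set)" by (rule finite_imp_compact) simp
  then have "compactin (product_topology (\<lambda>i::nat. euclidean :: bool topology) UNIV) (PiE UNIV (\<lambda>i. UNIV))"
    unfolding compactin_PiE by simp
  then show ?thesis by (simp add: euclidean_product_topology)
qed

theorem corollary1p2:
  fixes X :: "'a::metric_space set" and f :: "'a \<Rightarrow> 'a"
  assumes "compact X"
    and "continuous_on X f"
    and "f ` X \<subseteq> X"
    and "chain_recurrent X f"
    and "s_limit_shadowing X f"
    and "h_top X f > 0"
  shows "\<exists>S \<delta>. S \<subseteq> X \<and> S \<noteq> {} \<and> mycielski_set S \<and>
           (\<forall>n\<ge>2. \<delta> n > (0::real) \<and> dist_scrambled_set f n (\<delta> n) S)"
proof -
  interpret limit_shadowing_system X f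
    using assms by unfold_locales auto
  obtain p a b where pab: "p \<in> X" "a \<in> X" "b \<in> X" "a \<noteq> b"
    and split: "\<forall>\<delta>>0. \<exists>m. (p, a) \<in> step_rel X f \<delta> ^^ m \<and> (p, b) \<in> step_rel X f \<delta> ^^ m"
    using splitting_point[OF assms(6)] by blast
  have "\<forall>n::nat. \<exists>z \<eta>. 0 < \<eta> \<and> (\<forall>i. z i \<in> X) \<and> linked X f {..n} (\<lambda>_. p) z \<and>
      (\<forall>i\<le>n. \<forall>j\<le>n. i \<noteq> j \<longrightarrow> (\<forall>k. \<eta> \<le> dist ((f ^^ k) (z i)) ((f ^^ k) (z j))))"
    by (intro allI separated_tuple[OF pab(1,4) split])
  from choice[OF this] obtain Z where "\<forall>n::nat. \<exists>\<eta>. 0 < \<eta> \<and> (\<forall>i. Z n i \<in> X) \<and>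
      linked X f {..n} (\<lambda>_. p) (Z n) \<and>
      (\<forall>i\<le>n. \<forall>j\<le>n. i \<noteq> j \<longrightarrow> (\<forall>k. \<eta> \<le> dist ((f ^^ k) (Z n i)) ((f ^^ k) (Z n j))))"
    by (elim exE)
  from choice[OF this] obtain \<eta> where Z\<eta>: "\<forall>n::nat. 0 < \<eta> n \<and> (\<forall>i. Z n i \<in> X) \<and>
      linked X f {..n} (\<lambda>_. p) (Z n) \<and>
      (\<forall>i\<le>n. \<forall>j\<le>n. i \<noteq> j \<longrightarrow> (\<forall>k. \<eta> n \<le> dist ((f ^^ k) (Z n i)) ((f ^^ k) (Z n j))))"
    by (elim exE)
  then have \<eta>: "\<And>n. 0 < \<eta> n" and Z: "\<And>n i. Z n i \<in> X" "\<And>n. linked X f {..n} (\<lambda>_. p) (Z n)"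
    and sep: "\<And>n i j k. \<lbrakk>i \<le> n; j \<le> n; i \<noteq> j\<rbrakk> \<Longrightarrow> \<eta> n \<le> dist ((f ^^ k) (Z n i)) ((f ^^ k) (Z n j))"
    by blast+
  \<comment> \<open>A sequence of word lists that contains every list infinitely often.\<close>
  define W :: "nat \<Rightarrow> bool list list" where "W s = from_nat (fst (prod_decode s))" for s
  have W_infinite: "infinite ({s. W s = V} - {..<s0})" for V s0
  proof -
    have "range (\<lambda>j. prod_encode (to_nat V, j)) \<subseteq> {s. W s = V}" by (auto simp: W_def)
    moreover have "infinite (range (\<lambda>j. prod_encode (to_nat V, j)))"
      by (rule range_inj_infinite) (auto intro!: injI dest: injD[OF inj_prod_encode])
    ultimately show ?thesis using infinite_super Diff_infinite_finite[of "{..<s0}"] by blast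
  qed
  have targets: "Z (length (W s)) ` {..length (W s)} \<subseteq> X" for s using Z(1) by auto
  have labels: "label (W s) \<alpha> \<in> {..length (W s)}" for s \<alpha> using label_le by auto
  obtain \<Phi> B where \<Phi>: "continuous_on UNIV \<Phi>" "range \<Phi> \<subseteq> X" and B: "\<And>s. s \<le> B s"
    and track: "\<And>s \<alpha> k. k \<le> s * B s \<Longrightarrow>
      dist ((f ^^ (B s + k)) (\<Phi> \<alpha>)) ((f ^^ k) (Z (length (W s)) (label (W s) \<alpha>))) \<le> 2 / 2 ^ s"
    by (rule tracking_map[where I = "\<lambda>s. {..length (W s)}" and z = "\<lambda>s. Z (length (W s))" and c = "\<lambda>s. label (W s)",
          OF pab(1) finite_atMost targets Z(2) labels label_locally_constant])
      (rule that; simp)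
  \<comment> \<open>For the empty list there is a single label, so all points follow the same orbit.\<close>
  have together: "dist ((f ^^ (B s + k)) (\<Phi> \<alpha>)) ((f ^^ (B s + k)) (\<Phi> \<beta>)) \<le> 4 / 2 ^ s"
    if "W s = []" "k \<le> s * B s" for s k \<alpha> \<beta>
    using track[OF that(2), of \<alpha>] track[OF that(2), of \<beta>] that(1)
      dist_triangle2[of "(f ^^ (B s + k)) (\<Phi> \<alpha>)" "(f ^^ (B s + k)) (\<Phi> \<beta>)" "(f ^^ k) (Z 0 0)"]
    by (simp add: label_def)
  have apart: "\<eta> (length (W s)) - 4 / 2 ^ s \<le> dist ((f ^^ (B s + k)) (\<Phi> \<alpha>)) ((f ^^ (B s + k)) (\<Phi> \<beta>))"
    if "label (W s) \<alpha> \<noteq> label (W s) \<beta>" "k \<le> s * B s" for s k \<alpha> \<beta>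
  proof -
    let ?z = "\<lambda>\<gamma>. (f ^^ k) (Z (length (W s)) (label (W s) \<gamma>))"
    have "\<eta> (length (W s)) \<le> dist (?z \<alpha>) (?z \<beta>)" using sep label_le that(1) by blast
    also have "\<dots> \<le> dist (?z \<alpha>) ((f ^^ (B s + k)) (\<Phi> \<alpha>)) +
        (dist ((f ^^ (B s + k)) (\<Phi> \<alpha>)) ((f ^^ (B s + k)) (\<Phi> \<beta>)) + dist ((f ^^ (B s + k)) (\<Phi> \<beta>)) (?z \<beta>))"
      by (meson add_left_mono dist_triangle order_trans)
    finally show ?thesis
      using track[OF that(2), of \<alpha>] track[OF that(2), of \<beta>] by (simp add: dist_commute)
  qed
  have small: "\<exists>s0. \<forall>s\<ge>s0. 4 / 2 ^ s < e" if "0 < e" for e :: real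
  proof -
    have "(\<lambda>s. 4 * (1 / 2) ^ s) \<longlonglongrightarrow> (0 :: real)"
      by (intro tendsto_mult_right_zero LIMSEQ_power_zero) simp
    from order_tendstoD(2)[OF this that] obtain s0 where "\<forall>s\<ge>s0. 4 * (1 / 2) ^ s < e"
      unfolding eventually_sequentially by (elim exE)
    then show ?thesis by (intro exI[of _ s0]) (simp add: power_one_over)
  qed
  have separating: "\<exists>V. length V = n \<and> (\<forall>i\<in>{1..n}. \<forall>j\<in>{1..n}. i \<noteq> j \<longrightarrow> label V (\<alpha> i) \<noteq> label V (\<alpha> j))"
    if inj: "inj_on \<alpha> {1..n}" for n and \<alpha> :: "nat \<Rightarrow> nat \<Rightarrow> bool"
  proof -
    obtain l where l: "inj_on (\<lambda>\<alpha>. map \<alpha> [0..<l]) (\<alpha> ` {1..n})"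
      using separating_prefix_length[of "\<alpha> ` {1..n}"] by auto
    define V where "V = map (\<lambda>i. map (\<alpha> i) [0..<l]) [1..<Suc n]"
    have "V ! label V (\<alpha> i) = map (\<alpha> i) [0..<l]" if "i \<in> {1..n}" for i
      using that by (intro label_prefix) (auto simp: V_def simp del: upt_Suc)
    then have "label V (\<alpha> i) \<noteq> label V (\<alpha> j)" if "i \<in> {1..n}" "j \<in> {1..n}" "i \<noteq> j" for i j
      using that inj_onD[OF l] inj_onD[OF inj] by (metis imageI)
    moreover have "length V = n" by (simp add: V_def)
    ultimately show ?thesis by blast
  qed
  have scrambled: "dist_scrambled_tuple f n (\<eta> n / 2) x"
    if n: "2 \<le> n" and x: "\<And>i. i \<in> {1..n} \<Longrightarrow> x i = \<Phi> (\<alpha> i)" and inj: "inj_on \<alpha> {1..n}" for n x \<alpha>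
    unfolding dist_scrambled_tuple_def pair_dists_bounds[OF n]
  proof (intro conjI allI impI)
    fix \<epsilon> :: real assume "0 < \<epsilon>"
    then obtain s0 where s0: "\<forall>s\<ge>s0. 4 / 2 ^ s < \<epsilon>" using small by blast
    show "limsup (\<lambda>m. ereal (real (card {k. k < m \<and> (\<forall>i j. 1 \<le> i \<and> i < j \<and> j \<le> n \<longrightarrow>
        dist ((f ^^ k) (x i)) ((f ^^ k) (x j)) < \<epsilon>)}) / real m)) = 1"
    proof (rule limsup_density_eq_1[OF W_infinite[of "[]" s0]], rule B, intro allI impI)
      fix s k i j assume "s \<in> {s. W s = []} - {..<s0}" "k \<le> s * B s" "1 \<le> i \<and> i < j \<and> j \<le> n"
      then have "dist ((f ^^ (B s + k)) (x i)) ((f ^^ (B s + k)) (x j)) \<le> 4 / 2 ^ s"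
        using together[of s k "\<alpha> i" "\<alpha> j"] x[of i] x[of j] by auto
      also have "\<dots> < \<epsilon>" using s0 \<open>s \<in> _\<close> by auto
      finally show "dist ((f ^^ (B s + k)) (x i)) ((f ^^ (B s + k)) (x j)) < \<epsilon>" .
    qed
  next
    obtain V where V: "length V = n"
        "\<And>i j. i \<in> {1..n} \<Longrightarrow> j \<in> {1..n} \<Longrightarrow> i \<noteq> j \<Longrightarrow> label V (\<alpha> i) \<noteq> label V (\<alpha> j)"
      using separating[OF inj] by blast
    obtain s0 where s0: "\<forall>s\<ge>s0. 4 / 2 ^ s < \<eta> n / 2" using small[of "\<eta> n / 2"] \<eta>[of n] by auto
    show "limsup (\<lambda>m. ereal (real (card {k. k < m \<and> (\<forall>i j. 1 \<le> i \<and> i < j \<and> j \<le> n \<longrightarrow>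
        \<eta> n / 2 < dist ((f ^^ k) (x i)) ((f ^^ k) (x j)))}) / real m)) = 1"
    proof (rule limsup_density_eq_1[OF W_infinite[of V s0]], rule B, intro allI impI)
      fix s k i j assume *: "s \<in> {s. W s = V} - {..<s0}" "k \<le> s * B s" "1 \<le> i \<and> i < j \<and> j \<le> n"
      then have "4 / 2 ^ s < \<eta> n / 2" using s0 by auto
      moreover have "\<eta> n - 4 / 2 ^ s \<le> dist ((f ^^ (B s + k)) (x i)) ((f ^^ (B s + k)) (x j))"
        using apart[of s "\<alpha> i" "\<alpha> j" k] V(1) V(2)[of i j] x[of i] x[of j] * by auto
      ultimately show "\<eta> n / 2 < dist ((f ^^ (B s + k)) (x i)) ((f ^^ (B s + k)) (x j))" by linarith
    qed
  qed
  have "inj \<Phi>"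
  proof (rule injI, rule ccontr)
    fix \<alpha> \<beta> assume *: "\<Phi> \<alpha> = \<Phi> \<beta>" "\<alpha> \<noteq> \<beta>"
    define \<gamma> where "\<gamma> i = (if i = 1 then \<alpha> else \<beta>)" for i :: nat
    have "inj_on \<gamma> {1..2}"
      using *(2) by (auto simp: inj_on_def \<gamma>_def)
    from separating[OF this] obtain V where V: "length V = 2"
        "\<forall>i\<in>{1..2}. \<forall>j\<in>{1..2}. i \<noteq> j \<longrightarrow> label V (\<gamma> i) \<noteq> label V (\<gamma> j)"
      by (elim exE conjE)
    have "label V (\<gamma> 1) \<noteq> label V (\<gamma> 2)" by (rule V(2)[rule_format]) auto
    then have neq: "label V \<alpha> \<noteq> label V \<beta>" by (simp add: \<gamma>_def)
    obtain s0 where s0: "\<forall>s\<ge>s0. 4 / 2 ^ s < \<eta> 2" using small \<eta> by blast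
    have "{s. W s = V} - {..<s0} \<noteq> {}" using W_infinite[of V s0] by (metis finite.emptyI)
    then obtain s where "s \<in> {s. W s = V} - {..<s0}" by blast
    then have s: "W s = V" "s0 \<le> s" by auto
    then have "\<eta> 2 - 4 / 2 ^ s \<le> 0" using apart[of s \<alpha> \<beta> 0] V(1) neq *(1) by simp
    then show False using s0 s(2) by auto
  qed
  have "cantor_set (range \<Phi>)"
    unfolding cantor_set_def
    using homeomorphic_compact[OF compact_bool_sequences \<Phi>(1) refl \<open>inj \<Phi>\<close>] homeomorphic_sym by blast
  then have "mycielski_set (range \<Phi>)"
    unfolding mycielski_set_def by (intro exI[of _ "{range \<Phi>}"]) auto
  moreover have "dist_scrambled_set f n (\<eta> n / 2) (range \<Phi>)" if "2 \<le> n" for n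
    unfolding dist_scrambled_set_def
  proof (intro allI impI)
    fix x assume x: "x ` {1..n} \<subseteq> range \<Phi> \<and> inj_on x {1..n}"
    then have "\<forall>i\<in>{1..n}. \<exists>\<alpha>. x i = \<Phi> \<alpha>" by blast
    then obtain \<alpha> where \<alpha>: "\<And>i. i \<in> {1..n} \<Longrightarrow> x i = \<Phi> (\<alpha> i)" by metis
    moreover have "inj_on \<alpha> {1..n}" using x \<alpha> by (metis inj_on_def)
    ultimately show "dist_scrambled_tuple f n (\<eta> n / 2) x" using scrambled that by blast
  qed
  ultimately show ?thesis
    using \<Phi>(2) \<eta> by (intro exI[of _ "range \<Phi>"] exI[of _ "\<lambda>n. \<eta> n / 2"]) auto
qed

end
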